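(* Fix integers $r\ge 2$ and $\sigma\ge 1$ with $\sigma\le r$. For each $n\ge 1$ let $f$ be a uniformly random $r$-neighbor cellular automaton rule with $n$ states, and let $X_{\sigma,n}=X_{\sigma,n}(f)$ be the longest temporal period of a periodic solution of $f$ with spatial period $\sigma$. Then the random variables $$\frac{X_{\sigma,n}}{n^{\sigma/2}}$$ converge in distribution, as $n\to\infty$, to a nontrivial limit.
   Context: Let $\mathbb{Z}_n=\{0,1,\dots,n-1\}$. An $r$-neighbor rule is a function $f:\mathbb{Z}_n^r\to\mathbb{Z}_n$. Given an initial configuration $\xi_0:\mathbb{Z}\to\mathbb{Z}_n$, the cellular automaton (CA) trajectory is given by $\xi_{t+1}(x)=f(\xi_t(x-r+1),\dots,\xi_t(x))$ for all $x\in\mathbb{Z}$, $t\in\mathbb{Z}_+$. The set $\Omega_{r,n}$ of all $n^{n^r}$ such rules is equipped with the uniform probability measure. For a word $L$ of length $\sigma$ over $\mathbb{Z}_n$, let $L^\infty$ be the doubly infinite configuration obtained by repeating $L$. If the CA started from $\xi_0=L^\infty$ satisfies $\xi_\tau=\xi_0$ for some $\tau\ge1$, this is a periodic solution (PS) with temporal period $\tau$ and spatial period $\sigma$; both periods are assumed minimal: $L^\infty$ does not appear at any time $t$ with $0<t<\tau$, and $L$ cannot be divided into two or more identical words. $X_{\sigma,n}(f)$ is the largest temporal period among all PS of $f$ with spatial period $\sigma$ (and $X_{\sigma,n}(f)=0$ if $f$ has no such PS). "Nontrivial" means that the limiting distribution is not concentrated at a single point. *)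

theory Defs
  imports "HOL-Probability.Probability"
begin

text \<open>
  Words over \<open>\<int>\<^sub>n = {0, \<dots>, n - 1}\<close> are lists; they serve both as the arguments of a rule
  and as the words repeated in a spatially periodic configuration.
\<close>

definition words :: "nat \<Rightarrow> nat \<Rightarrow> nat list set" where
  "words n k = {w. set w \<subseteq> {..<n} \<and> length w = k}"

text \<open>Rules are extensional outside \<^term>\<open>words n r\<close>, so that distinct elements are distinct rules.\<close>

definition rules :: "nat \<Rightarrow> nat \<Rightarrow> (nat list \<Rightarrow> nat) set" where
  "rules r n = words n r \<rightarrow>\<^sub>E {..<n}"

lemma finite_words: "finite (words n k)"
  unfolding words_def by (intro finite_lists_length_eq) simp

lemma card_rules: "card (rules r n) = n ^ (n ^ r)"
  using card_lists_length_eq[of "{..<n}" r] finite_words[of n r]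
  by (simp add: rules_def card_PiE words_def)

type_synonym config = "int \<Rightarrow> nat"

definition ca_step :: "nat \<Rightarrow> (nat list \<Rightarrow> nat) \<Rightarrow> config \<Rightarrow> config" where
  "ca_step r f \<xi> = (\<lambda>x. f (map \<xi> [x - int r + 1..x]))"

text \<open>\<open>\<xi>\<^sub>t\<close>, when started from \<open>\<xi>\<^sub>0 = \<xi>\<close>.\<close>

definition trajectory :: "nat \<Rightarrow> (nat list \<Rightarrow> nat) \<Rightarrow> config \<Rightarrow> nat \<Rightarrow> config" where
  "trajectory r f \<xi> t = (ca_step r f ^^ t) \<xi>"

text \<open>The doubly infinite configuration \<open>L\<^sup>\<infinity>\<close> (for nonempty \<open>L\<close>).\<close>

definition repeat_word :: "nat list \<Rightarrow> config" where
  "repeat_word L = (\<lambda>x. L ! nat (x mod int (length L)))"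

definition primitive_word :: "nat list \<Rightarrow> bool" where
  "primitive_word L \<longleftrightarrow> \<not> (\<exists>w k. k \<ge> 2 \<and> L = concat (replicate k w))"

text \<open>
  \<open>L\<^sup>\<infinity>\<close> is a periodic solution of \<open>f\<close> with minimal temporal period \<open>\<tau>\<close> and
  minimal spatial period \<^term>\<open>length L\<close>.
\<close>

definition periodic_solution :: "nat \<Rightarrow> (nat list \<Rightarrow> nat) \<Rightarrow> nat list \<Rightarrow> nat \<Rightarrow> bool" where
  "periodic_solution r f L \<tau> \<longleftrightarrow>
     primitive_word L \<and> \<tau> \<ge> 1 \<and>
     trajectory r f (repeat_word L) \<tau> = repeat_word L \<and>
     (\<forall>t. 0 < t \<and> t < \<tau> \<longrightarrow> trajectory r f (repeat_word L) t \<noteq> repeat_word L)"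

definition temporal_periods :: "nat \<Rightarrow> nat \<Rightarrow> nat \<Rightarrow> (nat list \<Rightarrow> nat) \<Rightarrow> nat set" where
  "temporal_periods r \<sigma> n f = {\<tau>. \<exists>L \<in> words n \<sigma>. periodic_solution r f L \<tau>}"

text \<open>Each word has at most one minimal temporal period, so the maximum below is over a finite set.\<close>

lemma finite_temporal_periods: "finite (temporal_periods r \<sigma> n f)"
proof -
  have "finite {\<tau>. periodic_solution r f L \<tau>}" for L
  proof (cases "\<exists>\<tau>. periodic_solution r f L \<tau>")
    case True
    then obtain \<tau> where \<tau>: "periodic_solution r f L \<tau>" by blast
    have "\<tau>' = \<tau>" if "periodic_solution r f L \<tau>'" for \<tau>'
      using that \<tau> unfolding periodic_solution_def
      by (metis less_le_trans linorder_neqE_nat zero_less_one)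
    then have "{\<tau>. periodic_solution r f L \<tau>} \<subseteq> {\<tau>}" by blast
    then show ?thesis by (rule finite_subset) simp
  qed simp
  moreover have "temporal_periods r \<sigma> n f = (\<Union>L \<in> words n \<sigma>. {\<tau>. periodic_solution r f L \<tau>})"
    by (auto simp: temporal_periods_def)
  ultimately show ?thesis by (simp add: finite_words)
qed

definition longest_period :: "nat \<Rightarrow> nat \<Rightarrow> nat \<Rightarrow> (nat list \<Rightarrow> nat) \<Rightarrow> nat" where
  "longest_period r \<sigma> n f =
     (if temporal_periods r \<sigma> n f = {} then 0 else Max (temporal_periods r \<sigma> n f))"

text \<open>The law of \<open>X\<^bsub>\<sigma>,n\<^esub> / n\<^bsup>\<sigma>/2\<^esup>\<close> for a uniformly random rule.\<close>

definition scaled_period_law :: "nat \<Rightarrow> nat \<Rightarrow> nat \<Rightarrow> real measure" where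
  "scaled_period_law r \<sigma> n =
     distr (uniform_count_measure (rules r n)) borel
       (\<lambda>f. real (longest_period r \<sigma> n f) / real n powr (real \<sigma> / 2))"

end

theory Submission
  imports Defs
begin

text \<open>
  Since \<open>\<sigma> \<le> r\<close>, the windows of a primitive word of length \<open>\<sigma>\<close> are pairwise distinct and determine
  its rotation class. So a random rule acts on primitive words as a uniformly random map that commutes
  with rotation; a word leaves the primitive words with probability of order \<open>n\<^sup>-\<^sup>\<sigma>\<^sup>/\<^sup>2\<close> at most,
  and never returns.

  Let \<open>W\<close> be the number of cycles of rotation classes with temporal period exceeding
  \<open>x n\<^sup>\<sigma>\<^sup>/\<^sup>2\<close>, so that the scaled period is at most \<open>x\<close> iff \<open>W = 0\<close>. The factorial
  moments of \<open>W\<close> are explicit sums over cycle lengths, with the moment of order \<open>k\<close> at most the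
  \<open>k\<close>-th power of the mean, and the mean is \<open>O(1/x)\<close> uniformly in \<open>n\<close>. As \<open>n \<rightarrow> \<infinity>\<close> they are
  Riemann sums, which converge by dominated convergence. Inclusion-exclusion and Tannery's theorem
  then give convergence of the distribution functions at every \<open>x \<noteq> 0\<close>, the bound on the mean gives
  tightness, and a Bonferroni inequality shows that the limit has unbounded support.
\<close>

subsection \<open>Words, windows and rotations\<close>

text \<open>The scale comes from how long a trajectory avoids repetition. Write
  \<open>N = n ^ \<sigma>\<close> and let \<open>a\<close> be the number of primitive words. After
  \<open>j\<close> classes the next image is primitive and in a new class with probability
  \<open>(a - j * \<sigma>) / N\<close>. Over \<open>z * sqrt N\<close> steps the used classes cost
  a factor tending to \<open>exp (- \<sigma> * z^2 / 2)\<close>. The non-primitive words cost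
  \<open>exp (- \<kappa> * z)\<close>. For even \<sigma> the squares number exactly
  \<open>sqrt N\<close>, so this factor persists with \<kappa> = 1, while \<kappa> = 0 for odd
  \<sigma>. The temporal period is not the number of classes on a cycle: one turn may rotate the
  word by some \<open>s\<close>, which multiplies the period by the order of \<open>s\<close> modulo
  \<sigma>. Cycles are therefore handled with a marked start and a shift, and a weight divides the
  marking out. Cycles are counted rather than periodic words because one cycle of the relevant
  length holds of order \<open>sqrt N\<close> words. Several cycles compete for the same words,
  which only lowers their joint probability; this is why the moment of order \<open>k\<close> is at
  most the \<open>k\<close>-th power of the mean, small enough against \<open>k!\<close>. The bound
  on the mean blows up at \<open>x = 0\<close>, hence the excluded point.\<close>

lemma card_words: "card (words n k) = n ^ k"
  using card_lists_length_eq[of "{..<n}" k] by (simp add: words_def)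

lemma repeat_word_cong_mod:
  "x mod int (length L) = y mod int (length L) \<Longrightarrow> repeat_word L x = repeat_word L y"
  by (simp add: repeat_word_def)

lemma repeat_word_of_nat: "i < length L \<Longrightarrow> repeat_word L (int i) = L ! i"
  by (simp add: repeat_word_def)

lemma repeat_word_inject:
  assumes "length L = length L'" "repeat_word L = repeat_word L'"
  shows "L = L'"
  using assms by (intro nth_equalityI) (metis repeat_word_of_nat)+

lemma repeat_word_rotate:
  assumes "L \<noteq> []"
  shows "repeat_word (rotate k L) x = repeat_word L (x + int k)"
proof -
  let ?m = "length L"
  have m: "0 < ?m" using assms by simp
  have lt: "nat (x mod int ?m) < ?m" using m by (simp add: nat_less_iff)
  have "int ((k + nat (x mod int ?m)) mod ?m) = (int k + x mod int ?m) mod int ?m"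
    using m by (simp add: zmod_int)
  also have "\<dots> = (x + int k) mod int ?m" by (simp add: mod_add_right_eq add.commute)
  finally have "nat ((x + int k) mod int ?m) = (k + nat (x mod int ?m)) mod ?m"
    by (metis nat_int)
  then show ?thesis using lt by (simp add: repeat_word_def nth_rotate)
qed

lemma upto_eq_map_upt: "[a..b] = map (\<lambda>i. a + int i) [0..<nat (b - a + 1)]"
  by (rule nth_equalityI) auto

definition window :: "nat \<Rightarrow> nat list \<Rightarrow> int \<Rightarrow> nat list" where
  "window r L x = map (repeat_word L) [x - int r + 1..x]"

lemma window_eq: "window r L x = map (\<lambda>i. repeat_word L (x - int r + 1 + int i)) [0..<r]"
  by (simp add: window_def upto_eq_map_upt)

lemma length_window [simp]: "length (window r L x) = r"
  by (simp add: window_eq)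

lemma window_cong_mod:
  assumes "x mod int (length L) = y mod int (length L)"
  shows "window r L x = window r L y"
proof -
  have "(x - int r + 1 + int i) mod int (length L) = (y - int r + 1 + int i) mod int (length L)" for i
    using mod_add_cong[OF assms refl, of "1 + int i - int r"] by (simp add: algebra_simps)
  then show ?thesis
    unfolding window_eq by (intro map_cong refl repeat_word_cong_mod)
qed

lemma window_rotate: "L \<noteq> [] \<Longrightarrow> window r (rotate k L) x = window r L (x + int k)"
  by (simp add: window_eq repeat_word_rotate algebra_simps)

lemma repeat_word_in: "L \<noteq> [] \<Longrightarrow> repeat_word L x \<in> set L"
  by (simp add: repeat_word_def nat_less_iff)

lemma window_in_words:
  assumes "L \<in> words n \<sigma>" "\<sigma> > 0"
  shows "window r L x \<in> words n r"
proof -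
  have "L \<noteq> []" using assms by (auto simp: words_def)
  then have "set (window r L x) \<subseteq> set L" by (auto simp: window_eq repeat_word_in)
  then show ?thesis using assms by (auto simp: words_def)
qed

definition word_step :: "nat \<Rightarrow> (nat list \<Rightarrow> nat) \<Rightarrow> nat list \<Rightarrow> nat list" where
  "word_step r f L = map (\<lambda>j. f (window r L (int j))) [0..<length L]"

lemma length_word_step [simp]: "length (word_step r f L) = length L"
  by (simp add: word_step_def)

text \<open>A window depends on its end point only modulo the length of the word, so a step keeps
  the spatial period. The infinite system becomes the map \<open>word_step\<close> on words of fixed
  length.\<close>

lemma ca_step_repeat_word:
  assumes "L \<noteq> []"
  shows "ca_step r f (repeat_word L) = repeat_word (word_step r f L)"
proof
  fix x
  let ?m = "length L"
  have "nat (x mod int ?m) < ?m" using assms by (simp add: nat_less_iff)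
  then have "repeat_word (word_step r f L) x = f (window r L (x mod int ?m))"
    using assms by (simp add: repeat_word_def word_step_def)
  also have "window r L (x mod int ?m) = window r L x" by (rule window_cong_mod) simp
  finally show "ca_step r f (repeat_word L) x = repeat_word (word_step r f L) x"
    by (simp add: ca_step_def window_def)
qed

lemma word_step_eq_Nil [simp]: "word_step r f L = [] \<longleftrightarrow> L = []"
  by (simp add: word_step_def)

text \<open>Translation invariance of the automaton, seen on one spatial period.\<close>

lemma word_step_rotate: "word_step r f (rotate k L) = rotate k (word_step r f L)"
proof (cases "L = []")
  case False
  show ?thesis
  proof (rule nth_equalityI)
    fix i assume "i < length (word_step r f (rotate k L))"
    then have i: "i < length L" by simp
    have m: "(k + i) mod length L < length L" using False by simp
    have "window r L (int i + int k) = window r L (int ((k + i) mod length L))"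
      by (rule window_cong_mod) (simp add: zmod_int add.commute)
    then show "word_step r f (rotate k L) ! i = rotate k (word_step r f L) ! i"
      using i m False by (simp add: word_step_def nth_rotate window_rotate)
  qed simp
qed (simp add: word_step_def)

lemma length_word_step_funpow [simp]: "length ((word_step r f ^^ t) L) = length L"
  by (induction t) auto

lemma word_step_funpow_rotate:
  "(word_step r f ^^ t) (rotate k L) = rotate k ((word_step r f ^^ t) L)"
  by (induction t) (simp_all add: word_step_rotate)

lemma trajectory_repeat_word:
  assumes "L \<noteq> []"
  shows "trajectory r f (repeat_word L) t = repeat_word ((word_step r f ^^ t) L)"
proof -
  have "(word_step r f ^^ t) L \<noteq> []" for t
    using assms length_word_step_funpow[of t r f L] by (metis length_0_conv)
  then show ?thesis
    unfolding trajectory_def by (induction t) (simp_all add: ca_step_repeat_word)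
qed

section \<open>Primitivity and rotation classes\<close>

text \<open>If a proper rotation fixes \<open>L\<close>, the two pieces into which it cuts
  \<open>L\<close> commute, and commuting words are powers of a common word.\<close>

lemma primitive_word_iff_rotate:
  assumes "L \<noteq> []"
  shows "primitive_word L \<longleftrightarrow> (\<forall>k. 0 < k \<and> k < length L \<longrightarrow> rotate k L \<noteq> L)"
proof
  assume P: "primitive_word L"
  show "\<forall>k. 0 < k \<and> k < length L \<longrightarrow> rotate k L \<noteq> L"
  proof (intro allI impI notI)
    fix k assume k: "0 < k \<and> k < length L" and eq: "rotate k L = L"
    have "drop k L @ take k L = L" using eq k by (simp add: rotate_drop_take)
    then have "take k L @ drop k L = drop k L @ take k L" by simp
    moreover have "take k L \<noteq> []" "drop k L \<noteq> []" using k by auto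
    ultimately obtain m zs where "m > 1" "concat (replicate m zs) = take k L @ drop k L"
      using comm_append_is_replicate by blast
    then have "2 \<le> m" "L = concat (replicate m zs)" by simp_all
    then show False using P unfolding primitive_word_def by blast
  qed
next
  assume R: "\<forall>k. 0 < k \<and> k < length L \<longrightarrow> rotate k L \<noteq> L"
  show "primitive_word L"
    unfolding primitive_word_def
  proof
    assume "\<exists>w k. 2 \<le> k \<and> L = concat (replicate k w)"
    then obtain w k where k: "2 \<le> k" and L: "L = concat (replicate k w)" by blast
    obtain j where j: "k = Suc j" "1 \<le> j" using k by (cases k) auto
    have len: "length L = k * length w" using L by (simp add: length_concat sum_list_replicate)
    have w: "0 < length w" using assms len by (cases "length w") auto
    have "rotate (length w) L = concat (replicate j w) @ w"
      using L j by (simp add: rotate_append)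
    also have "\<dots> = concat (replicate j w @ [w])" by simp
    also have "\<dots> = concat (replicate (Suc j) w)" by (simp add: replicate_append_same)
    also have "\<dots> = L" using L j by simp
    finally show False using R w len k by auto
  qed
qed

lemma inj_rotate: "inj (rotate k)"
  unfolding rotate_def by (intro inj_fn inj_rotate1)

lemma primitive_word_rotate:
  assumes "L \<noteq> []"
  shows "primitive_word (rotate k L) \<longleftrightarrow> primitive_word L"
proof -
  have "rotate i (rotate k L) = rotate k L \<longleftrightarrow> rotate i L = L" for i
  proof -
    have "rotate i (rotate k L) = rotate k (rotate i L)" by (simp add: rotate_rotate add.commute)
    then show ?thesis using injD[OF inj_rotate] by (metis)
  qed
  then show ?thesis using assms by (simp add: primitive_word_iff_rotate)
qed

lemma rotate_eq_self_iff:
  assumes "primitive_word L" "L \<noteq> []"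
  shows "rotate k L = L \<longleftrightarrow> length L dvd k"
proof -
  have "rotate k L = rotate (k mod length L) L" by (rule rotate_conv_mod)
  moreover have "k mod length L < length L" using assms by simp
  ultimately show ?thesis
    using assms by (metis primitive_word_iff_rotate dvd_eq_mod_eq_0 gr0I rotate0 id_apply)
qed

lemma rotate_eq_rotate_iff:
  assumes "primitive_word L" "L \<noteq> []"
  shows "rotate i L = rotate j L \<longleftrightarrow> i mod length L = j mod length L"
proof -
  have *: "rotate i L = rotate j L \<longleftrightarrow> i mod length L = j mod length L" if "i \<le> j" for i j
  proof -
    have "rotate j L = rotate i (rotate (j - i) L)" using that by (simp add: rotate_rotate)
    then have "rotate i L = rotate j L \<longleftrightarrow> rotate (j - i) L = L"
      using injD[OF inj_rotate] by metis
    also have "\<dots> \<longleftrightarrow> length L dvd j - i" by (rule rotate_eq_self_iff[OF assms])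
    also have "\<dots> \<longleftrightarrow> i mod length L = j mod length L"
      using that by (metis mod_eq_dvd_iff_nat)
    finally show ?thesis .
  qed
  show ?thesis using *[of i j] *[of j i] by (metis nat_le_linear)
qed

text \<open>A rotation that fixes \<open>L\<close> also fixes its image. Read backwards: a
  trajectory that meets a non-primitive word stays among such words, so no cycle of primitive words
  passes through one.\<close>

lemma primitive_word_of_step:
  assumes "primitive_word (word_step r f L)" "L \<noteq> []"
  shows "primitive_word L"
proof -
  have "rotate k L \<noteq> L" if "0 < k" "k < length L" for k
    using that assms by (metis length_word_step word_step_eq_Nil primitive_word_iff_rotate word_step_rotate)
  then show ?thesis using assms by (simp add: primitive_word_iff_rotate)
qed

definition orb :: "nat list \<Rightarrow> nat list set" where
  "orb L = range (\<lambda>k. rotate k L)"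

lemma orb_self [simp]: "L \<in> orb L"
  unfolding orb_def by (metis rangeI rotate0 id_apply)

lemma rotate_in_orb [simp]: "rotate k L \<in> orb L"
  by (auto simp: orb_def)

lemma orb_sym: "L' \<in> orb L \<Longrightarrow> L \<in> orb L'"
proof -
  assume "L' \<in> orb L"
  then obtain k where k: "L' = rotate k L" by (auto simp: orb_def)
  show "L \<in> orb L'"
  proof (cases "L = []")
    case False
    have "rotate (length L - k mod length L) L' = rotate ((length L - k mod length L) + k mod length L) L"
      unfolding k by (metis rotate_conv_mod rotate_rotate)
    also have "\<dots> = L" using False by (simp add: less_imp_le_nat)
    finally show ?thesis by (metis rotate_in_orb)
  qed (use k in simp)
qed

lemma orb_trans: "L' \<in> orb L \<Longrightarrow> L'' \<in> orb L' \<Longrightarrow> L'' \<in> orb L"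
  by (auto simp: orb_def rotate_rotate)

lemma orb_eqI: "L' \<in> orb L \<Longrightarrow> orb L' = orb L"
  using orb_sym orb_trans by blast

lemma orb_eq_iff: "orb L' = orb L \<longleftrightarrow> L' \<in> orb L"
  using orb_eqI orb_self by blast

lemma orb_Int_empty_iff: "orb L \<inter> orb L' = {} \<longleftrightarrow> orb L \<noteq> orb L'"
proof
  assume *: "orb L \<noteq> orb L'"
  have "orb L = orb L'" if "x \<in> orb L" "x \<in> orb L'" for x
    using orb_eqI[OF that(1)] orb_eqI[OF that(2)] by simp
  then show "orb L \<inter> orb L' = {}" using * by blast
qed (use orb_self in blast)

lemma orb_rotate [simp]: "orb (rotate k L) = orb L"
  by (rule orb_eqI) simp

lemma orb_eq_image: "L \<noteq> [] \<Longrightarrow> orb L = (\<lambda>k. rotate k L) ` {..<length L}"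
  unfolding orb_def by (auto simp: image_iff) (metis length_greater_0_conv lessThan_iff mod_less_divisor rotate_conv_mod)

lemma card_orb:
  assumes "primitive_word L" "L \<noteq> []"
  shows "card (orb L) = length L"
proof -
  have "inj_on (\<lambda>k. rotate k L) {..<length L}"
    by (auto simp: inj_on_def rotate_eq_rotate_iff[OF assms])
  then show ?thesis using assms by (simp add: orb_eq_image card_image)
qed

definition pwords :: "nat \<Rightarrow> nat \<Rightarrow> nat list set" where
  "pwords n \<sigma> = {L \<in> words n \<sigma>. primitive_word L}"

lemma finite_pwords [simp]: "finite (pwords n \<sigma>)"
  by (simp add: pwords_def finite_words)

lemma pwordsD:
  "L \<in> pwords n \<sigma> \<Longrightarrow> length L = \<sigma>" "L \<in> pwords n \<sigma> \<Longrightarrow> primitive_word L"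
  "L \<in> pwords n \<sigma> \<Longrightarrow> L \<in> words n \<sigma>"
  by (auto simp: pwords_def words_def)

lemma orb_subset_pwords:
  assumes "L \<in> pwords n \<sigma>" "\<sigma> > 0"
  shows "orb L \<subseteq> pwords n \<sigma>"
proof -
  have "L \<noteq> []" using assms by (auto dest: pwordsD)
  then show ?thesis
    using assms by (auto simp: orb_def pwords_def words_def primitive_word_rotate)
qed

section \<open>Free lists and the independence of their images\<close>

text \<open>Free in the sense that the images of all entries under a rule can be prescribed
  independently; see \<open>card_rules_prescribed\<close>.\<close>

definition free_lists :: "nat \<Rightarrow> nat \<Rightarrow> nat \<Rightarrow> nat list list set" where
  "free_lists n \<sigma> m = {u. set u \<subseteq> pwords n \<sigma> \<and> length u = m \<and> distinct (map orb u)}"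

lemma finite_free_lists [simp]: "finite (free_lists n \<sigma> m)"
  by (rule finite_subset[OF _ finite_lists_length_eq[of "pwords n \<sigma>" m]]) (auto simp: free_lists_def)

lemma card_UN_orb:
  assumes "\<sigma> > 0" "u \<in> free_lists n \<sigma> m"
  shows "card (\<Union>w\<in>set u. orb w) = m * \<sigma>"
proof -
  have d: "distinct (map orb u)" "length u = m" and uA: "set u \<subseteq> pwords n \<sigma>"
    using assms by (auto simp: free_lists_def)
  have cu: "card (set u) = m" using d by (metis distinct_card distinct_map)
  have co: "card (orb w) = \<sigma>" if "w \<in> set u" for w
    using that uA assms card_orb pwordsD(1,2) by (metis length_0_conv less_numeral_extra(3) subsetD)
  have "card (\<Union>w\<in>set u. orb w) = (\<Sum>w\<in>set u. card (orb w))"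
  proof (rule card_UN_disjoint)
    show "\<forall>w\<in>set u. finite (orb w)"
      using co assms(1) by (metis card.infinite less_irrefl)
    show "\<forall>i\<in>set u. \<forall>j\<in>set u. i \<noteq> j \<longrightarrow> orb i \<inter> orb j = {}"
    proof (intro ballI impI)
      fix i j assume ij: "i \<in> set u" "j \<in> set u" "i \<noteq> j"
      then have "orb i \<noteq> orb j" using d(1) by (auto simp: distinct_map inj_on_def)
      then show "orb i \<inter> orb j = {}" by (simp add: orb_Int_empty_iff)
    qed
  qed simp
  also have "\<dots> = m * \<sigma>" using co cu by simp
  finally show ?thesis .
qed

text \<open>Given \<open>u\<close>, the next word must avoid the \<open>m * \<sigma>\<close> words
  of the classes in use. These lie in \<open>pwords\<close>, so the truncated subtraction is exact
  whenever some \<open>u\<close> exists; otherwise both sides are \<open>0\<close>.\<close>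

lemma card_free_lists_Suc:
  assumes "\<sigma> > 0"
  shows "card (free_lists n \<sigma> (Suc m)) = card (free_lists n \<sigma> m) * (card (pwords n \<sigma>) - m * \<sigma>)"
proof -
  let ?A = "pwords n \<sigma>"
  define E where "E u = ?A - (\<Union>w\<in>set u. orb w)" for u
  have eq: "free_lists n \<sigma> (Suc m) = (\<lambda>(u, v). v # u) ` (SIGMA u : free_lists n \<sigma> m. E u)"
  proof (intro equalityI subsetI)
    fix x assume "x \<in> free_lists n \<sigma> (Suc m)"
    then obtain v u where x: "x = v # u" and vu: "set x \<subseteq> ?A" "length u = m" "distinct (map orb x)"
      by (auto simp: free_lists_def length_Suc_conv)
    have "u \<in> free_lists n \<sigma> m" using x vu by (auto simp: free_lists_def)
    moreover have "v \<in> E u" using x vu by (auto simp: E_def orb_eq_iff image_iff dest: orb_eqI)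
    ultimately show "x \<in> (\<lambda>(u, v). v # u) ` (SIGMA u : free_lists n \<sigma> m. E u)" using x by force
  next
    fix x assume "x \<in> (\<lambda>(u, v). v # u) ` (SIGMA u : free_lists n \<sigma> m. E u)"
    then show "x \<in> free_lists n \<sigma> (Suc m)"
      by (auto simp: free_lists_def E_def)
  qed
  have cE: "card (E u) = card ?A - m * \<sigma>" if u: "u \<in> free_lists n \<sigma> m" for u
  proof -
    have sub: "(\<Union>w\<in>set u. orb w) \<subseteq> ?A"
      using u assms orb_subset_pwords by (fastforce simp: free_lists_def)
    show ?thesis
      unfolding E_def using sub card_UN_orb[OF assms u] by (simp add: card_Diff_subset finite_subset)
  qed
  have "card (free_lists n \<sigma> (Suc m)) = card (SIGMA u : free_lists n \<sigma> m. E u)"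
    unfolding eq by (rule card_image) (auto simp: inj_on_def)
  also have "\<dots> = (\<Sum>u\<in>free_lists n \<sigma> m. card (E u))"
    by (rule card_SigmaI) (auto simp: E_def)
  also have "\<dots> = card (free_lists n \<sigma> m) * (card ?A - m * \<sigma>)" using cE by simp
  finally show ?thesis .
qed

lemma card_free_lists:
  assumes "\<sigma> > 0"
  shows "card (free_lists n \<sigma> m) = (\<Prod>j<m. card (pwords n \<sigma>) - j * \<sigma>)"
proof (induction m)
  case 0
  have "free_lists n \<sigma> 0 = {[]}" by (auto simp: free_lists_def)
  then show ?case by simp
qed (simp add: card_free_lists_Suc[OF assms])

text \<open>As \<sigma> \<le> r, a window contains a whole spatial period: its first \<sigma>
  letters spell a rotation of the word. Equal windows give equal rotations, and primitivity then
  recovers the position modulo \<sigma>.\<close>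

lemma window_eq_imp:
  assumes uv: "u \<in> pwords n \<sigma>" "v \<in> pwords n \<sigma>" "\<sigma> > 0" "\<sigma> \<le> r"
    and eq: "window r u x = window r v y"
  shows "orb u = orb v" and "u = v \<Longrightarrow> x mod int \<sigma> = y mod int \<sigma>"
proof -
  have len: "length u = \<sigma>" "length v = \<sigma>" and prim: "primitive_word u" "primitive_word v"
    using uv pwordsD by blast+
  have ne: "u \<noteq> []" "v \<noteq> []" using len uv by auto
  have 1: "repeat_word u (x - int r + 1 + int i) = repeat_word v (y - int r + 1 + int i)"
    if "i < r" for i using eq that unfolding window_eq by (auto simp: map_eq_conv)
  \<comment> \<open>The window ending at \<open>x\<close> starts at \<open>x - int r + 1\<close>, so
    it opens with the letters of \<open>rotate p u\<close>.\<close>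
  define p where "p = nat ((x - int r + 1) mod int \<sigma>)"
  define q where "q = nat ((y - int r + 1) mod int \<sigma>)"
  have ip: "int p = (x - int r + 1) mod int \<sigma>" and iq: "int q = (y - int r + 1) mod int \<sigma>"
    using uv by (simp_all add: p_def q_def)
  have "rotate p u = rotate q v"
  proof (rule nth_equalityI)
    show "length (rotate p u) = length (rotate q v)" using len by simp
    fix i assume "i < length (rotate p u)"
    then have i: "i < \<sigma>" using len by simp
    have "rotate p u ! i = repeat_word u (int i + int p)"
      using i len repeat_word_of_nat[of i "rotate p u"] repeat_word_rotate[OF ne(1)] by simp
    also have "\<dots> = repeat_word u (x - int r + 1 + int i)"
      by (rule repeat_word_cong_mod) (simp add: len ip mod_add_right_eq add.commute)
    also have "\<dots> = repeat_word v (y - int r + 1 + int i)" using i uv by (intro 1) simp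
    also have "\<dots> = repeat_word v (int i + int q)"
      by (rule repeat_word_cong_mod) (simp add: len iq mod_add_right_eq add.commute)
    also have "\<dots> = rotate q v ! i"
      using i len repeat_word_of_nat[of i "rotate q v"] repeat_word_rotate[OF ne(2)] by simp
    finally show "rotate p u ! i = rotate q v ! i" .
  qed
  then show "orb u = orb v" by (metis orb_rotate)
  assume "u = v"
  then have "p mod \<sigma> = q mod \<sigma>" using \<open>rotate p u = rotate q v\<close> rotate_eq_rotate_iff[OF prim(1) ne(1)] len by simp
  then have "int p mod int \<sigma> = int q mod int \<sigma>" by (metis zmod_int)
  then have "(x - int r + 1) mod int \<sigma> = (y - int r + 1) mod int \<sigma>" by (simp add: ip iq)
  then have "(x - int r + 1 + (int r - 1)) mod int \<sigma> = (y - int r + 1 + (int r - 1)) mod int \<sigma>"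
    by (rule mod_add_cong) simp
  then show "x mod int \<sigma> = y mod int \<sigma>" by simp
qed

text \<open>
  The words \<open>u\<close> have pairwise disjoint sets of windows, all of which are distinct because \<open>\<sigma> \<le> r\<close>.
  Hence their images are independent and uniform.
\<close>

lemma card_rules_prescribed:
  assumes u: "u \<in> free_lists n \<sigma> m" and t: "set t \<subseteq> words n \<sigma>" "length t = m"
    and "\<sigma> > 0" "\<sigma> \<le> r" "n > 0"
  shows "real (card {f \<in> rules r n. map (word_step r f) u = t})
           = real (card (rules r n)) / real (n ^ \<sigma>) ^ m"
proof -
  define I where "I = {..<m} \<times> {..<\<sigma>}"
  define win where "win = (\<lambda>(i, j). window r (u ! i) (int j))"
  have uA: "u ! i \<in> pwords n \<sigma>" if "i < m" for i
    using that u by (auto simp: free_lists_def)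
  have lu: "length u = m" using u by (simp add: free_lists_def)
  have inj: "inj_on win I"
  proof (rule inj_onI, clarsimp simp: I_def win_def)
    fix i j i' j' assume *: "i < m" "j < \<sigma>" "i' < m" "j' < \<sigma>"
      and eq: "window r (u ! i) (int j) = window r (u ! i') (int j')"
    have "orb (u ! i) = orb (u ! i')" using window_eq_imp(1)[OF uA uA _ _ eq] * assms by simp
    then have "i = i'" using * u unfolding free_lists_def
      by (auto simp: distinct_conv_nth)
    moreover from this have "int j mod int \<sigma> = int j' mod int \<sigma>"
      using window_eq_imp(2)[OF uA uA _ _ eq] * assms by simp
    ultimately show "i = i' \<and> j = j'" using * by simp
  qed
  have sub: "win ` I \<subseteq> words n r"
    using window_in_words[OF pwordsD(3)[OF uA] \<open>\<sigma> > 0\<close>] by (auto simp: I_def win_def)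
  define g where "g w = (case the_inv_into I win w of (i, j) \<Rightarrow> t ! i ! j)" for w
  have g: "g (win (i, j)) = t ! i ! j" if "i < m" "j < \<sigma>" for i j
    using that inj by (simp add: g_def the_inv_into_f_f I_def)
  have lt: "length (t ! i) = \<sigma>" "set (t ! i) \<subseteq> {..<n}" if "i < m" for i
    using that t by (force simp: words_def)+
  \<comment> \<open>The rules sought form a product set: a single value at each of the
    \<open>m * \<sigma>\<close> windows, any of the \<open>n\<close> values at every other
    argument.\<close>
  define B where "B w = (if w \<in> win ` I then {g w} else {..<n})" for w
  have step_iff: "map (word_step r f) u = t \<longleftrightarrow> (\<forall>i<m. \<forall>j<\<sigma>. f (win (i, j)) = t ! i ! j)" for f
  proof -
    have "map (word_step r f) u = t \<longleftrightarrow> (\<forall>i<m. word_step r f (u ! i) = t ! i)"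
      using lu t by (auto simp: list_eq_iff_nth_eq)
    also have "\<dots> \<longleftrightarrow> (\<forall>i<m. \<forall>j<\<sigma>. f (win (i, j)) = t ! i ! j)"
    proof (intro all_cong)
      fix i assume i: "i < m"
      have "length (u ! i) = \<sigma>" using uA[OF i] by (rule pwordsD)
      then show "word_step r f (u ! i) = t ! i \<longleftrightarrow> (\<forall>j<\<sigma>. f (win (i, j)) = t ! i ! j)"
        using lt[OF i] by (auto simp: list_eq_iff_nth_eq word_step_def win_def)
    qed
    finally show ?thesis .
  qed
  have "{f \<in> rules r n. map (word_step r f) u = t} = Pi\<^sub>E (words n r) B"
  proof (intro equalityI subsetI)
    fix f assume f: "f \<in> {f \<in> rules r n. map (word_step r f) u = t}"
    then have F: "f \<in> words n r \<rightarrow>\<^sub>E {..<n}" "\<forall>i<m. \<forall>j<\<sigma>. f (win (i, j)) = t ! i ! j"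
      by (auto simp: rules_def step_iff)
    have "f w \<in> B w" if w: "w \<in> words n r" for w
    proof (cases "w \<in> win ` I")
      case True
      then obtain i j where "w = win (i, j)" "i < m" "j < \<sigma>" by (auto simp: I_def)
      then show ?thesis using F(2) g True by (auto simp: B_def)
    qed (use F(1) w in \<open>auto simp: B_def\<close>)
    then show "f \<in> Pi\<^sub>E (words n r) B" using F(1) by (auto simp: PiE_iff)
  next
    fix f assume f: "f \<in> Pi\<^sub>E (words n r) B"
    have P: "f (win (i, j)) = t ! i ! j" if ij: "i < m" "j < \<sigma>" for i j
    proof -
      have "win (i, j) \<in> win ` I" using ij by (auto simp: I_def)
      then have "f (win (i, j)) \<in> B (win (i, j))" "B (win (i, j)) = {g (win (i, j))}"
        using sub PiE_mem[OF f] by (blast, simp add: B_def)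
      then show ?thesis using g ij by auto
    qed
    have "f w < n" if w: "w \<in> words n r" for w
    proof (cases "w \<in> win ` I")
      case True
      then obtain i j where ij: "w = win (i, j)" "i < m" "j < \<sigma>" by (auto simp: I_def)
      then have "f w = t ! i ! j" using P by simp
      also have "\<dots> \<in> set (t ! i)" using lt ij by simp
      then have "t ! i ! j < n" using lt(2)[of i] ij by blast
      finally show ?thesis .
    next
      case False
      have "f w \<in> B w" using f w by blast
      then show ?thesis using False by (simp add: B_def)
    qed
    then have "f \<in> rules r n" using f by (auto simp: rules_def PiE_iff)
    then show "f \<in> {f \<in> rules r n. map (word_step r f) u = t}" using P by (simp add: step_iff)
  qed
  then have "card {f \<in> rules r n. map (word_step r f) u = t} = (\<Prod>w\<in>words n r. card (B w))"
    by (simp add: card_PiE finite_words)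
  also have "\<dots> = (\<Prod>w\<in>win ` I. card (B w)) * (\<Prod>w\<in>words n r - win ` I. card (B w))"
    by (subst prod.subset_diff[OF sub]) (simp_all add: finite_words mult.commute)
  also have "(\<Prod>w\<in>win ` I. card (B w)) = 1" by (simp add: B_def)
  also have "(\<Prod>w\<in>words n r - win ` I. card (B w)) = n ^ card (words n r - win ` I)"
    by (simp add: B_def)
  also have "card (words n r - win ` I) = n ^ r - \<sigma> * m"
  proof -
    have "card (win ` I) = \<sigma> * m" using inj by (simp add: card_image I_def)
    then show ?thesis using sub by (simp add: card_Diff_subset finite_subset finite_words card_words)
  qed
  finally have c: "card {f \<in> rules r n. map (word_step r f) u = t} = n ^ (n ^ r - \<sigma> * m)" by simp
  have le: "\<sigma> * m \<le> n ^ r"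
  proof -
    have "card (win ` I) \<le> card (words n r)" using sub by (intro card_mono) (simp_all add: finite_words)
    then show ?thesis using inj by (simp add: card_image I_def card_words mult.commute)
  qed
  show ?thesis
    unfolding c card_rules using assms(6) le
    by (subst of_nat_power, subst power_diff) (simp_all flip: power_mult)
qed

subsection \<open>Cycles of rotation classes\<close>

lemma sum_lists_Suc:
  fixes g :: "'a list \<Rightarrow> real"
  assumes "finite P"
  shows "(\<Sum>xs | length xs = Suc k \<and> set xs \<subseteq> P \<and> Q xs. g xs)
    = (\<Sum>xs | length xs = k \<and> set xs \<subseteq> P. \<Sum>x | x \<in> P \<and> Q (x # xs). g (x # xs))"
proof -
  have fin: "finite {xs. length xs = k \<and> set xs \<subseteq> P}"
    using finite_lists_length_eq[OF assms, of k] by (simp add: conj_commute)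
  have "(\<Sum>xs | length xs = k \<and> set xs \<subseteq> P. \<Sum>x | x \<in> P \<and> Q (x # xs). g (x # xs))
    = (\<Sum>(xs, x)\<in>(SIGMA xs : {xs. length xs = k \<and> set xs \<subseteq> P}. {x \<in> P. Q (x # xs)}). g (x # xs))"
    using assms fin by (intro sum.Sigma) auto
  also have "\<dots> = (\<Sum>xs | length xs = Suc k \<and> set xs \<subseteq> P \<and> Q xs. g xs)"
    by (rule sum.reindex_bij_witness[where j = "\<lambda>(xs, x). x # xs" and i = "\<lambda>xs. (tl xs, hd xs)"])
      (auto simp: length_Suc_conv)
  finally show ?thesis by simp
qed

text \<open>
  Weighting each point by the inverse size of its class, a sum over tuples of points becomes a count
  of tuples of distinct classes.
\<close>

lemma sum_distinct_classes:
  fixes K :: "'a \<Rightarrow> 'b"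
  assumes "finite P"
  shows "(\<Sum>xs | length xs = k \<and> set xs \<subseteq> P \<and> distinct (map K xs).
            \<Prod>x\<leftarrow>xs. 1 / real (card {y \<in> P. K y = K x}))
    = fact k * real (card (K ` P) choose k)"
proof (induction k)
  case 0
  have "{xs. xs = [] \<and> set xs \<subseteq> P \<and> distinct (map K xs)} = {[]}" by auto
  then show ?case by (simp cong: conj_cong)
next
  case (Suc k)
  define wt where "wt x = 1 / real (card {y \<in> P. K y = K x})" for x
  let ?g = "\<lambda>xs. \<Prod>x\<leftarrow>xs. wt x"
  let ?W = "card (K ` P)"
  let ?S = "\<lambda>k. {xs. length xs = k \<and> set xs \<subseteq> P \<and> distinct (map K xs)}"
  have fin: "finite (?S k)"
    by (rule finite_subset[OF _ finite_lists_length_eq[OF assms, of k]]) auto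
  have inner: "(\<Sum>x | x \<in> P \<and> K x \<notin> K ` set xs. wt x) = real ?W - real k" if xs: "xs \<in> ?S k" for xs
  proof -
    let ?C = "K ` set xs"
    have sub: "?C \<subseteq> K ` P" using xs by auto
    have cC: "card ?C = k" using xs distinct_card[of "map K xs"] by simp
    have "(\<Sum>x | x \<in> P \<and> K x \<notin> ?C. wt x)
      = (\<Sum>c\<in>K ` P - ?C. \<Sum>x | x \<in> {x \<in> P. K x \<notin> ?C} \<and> K x = c. wt x)"
      using assms by (intro sum.group[symmetric]) auto
    also have "\<dots> = (\<Sum>c\<in>K ` P - ?C. 1)"
    proof (rule sum.cong[OF refl])
      fix c assume c: "c \<in> K ` P - ?C"
      then have eq: "{x. x \<in> {x \<in> P. K x \<notin> ?C} \<and> K x = c} = {x \<in> P. K x = c}"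
        by (auto simp: image_iff)
      have ne: "{x \<in> P. K x = c} \<noteq> {}" "finite {x \<in> P. K x = c}" using c assms by auto
      have "(\<Sum>x | x \<in> P \<and> K x = c. wt x) = (\<Sum>x | x \<in> P \<and> K x = c. 1 / real (card {y \<in> P. K y = c}))"
        by (intro sum.cong) (auto simp: wt_def)
      also have "\<dots> = 1" using ne by (simp add: card_eq_0_iff)
      finally show "(\<Sum>x | x \<in> {x \<in> P. K x \<notin> ?C} \<and> K x = c. wt x) = 1" unfolding eq .
    qed
    also have "\<dots> = real (?W - k)"
      using sub assms cC by (simp add: card_Diff_subset finite_subset)
    also have "\<dots> = real ?W - real k"
      using card_mono[OF finite_imageI[OF assms] sub] cC by (simp add: of_nat_diff)
    finally show ?thesis .
  qed
  have "(\<Sum>xs\<in>?S (Suc k). ?g xs)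
    = (\<Sum>xs | length xs = k \<and> set xs \<subseteq> P. \<Sum>x | x \<in> P \<and> distinct (map K (x # xs)). ?g (x # xs))"
    by (rule sum_lists_Suc[OF assms])
  also have "\<dots> = (\<Sum>xs\<in>?S k. \<Sum>x | x \<in> P \<and> distinct (map K (x # xs)). ?g (x # xs))"
  proof (rule sum.mono_neutral_right)
    show "finite {xs. length xs = k \<and> set xs \<subseteq> P}"
      using finite_lists_length_eq[OF assms, of k] by (simp add: conj_commute)
    show "\<forall>xs\<in>{xs. length xs = k \<and> set xs \<subseteq> P} - ?S k.
        (\<Sum>x | x \<in> P \<and> distinct (map K (x # xs)). ?g (x # xs)) = 0"
    proof
      fix xs assume "xs \<in> {xs. length xs = k \<and> set xs \<subseteq> P} - ?S k"
      then have "{x. x \<in> P \<and> distinct (map K (x # xs))} = {}" by auto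
      then show "(\<Sum>x | x \<in> P \<and> distinct (map K (x # xs)). ?g (x # xs)) = 0"
        by (simp only: sum.empty)
    qed
  qed auto
  also have "\<dots> = (\<Sum>xs\<in>?S k. ?g xs * (real ?W - real k))"
  proof (rule sum.cong[OF refl])
    fix xs assume xs: "xs \<in> ?S k"
    then have "{x. x \<in> P \<and> distinct (map K (x # xs))} = {x. x \<in> P \<and> K x \<notin> K ` set xs}" by auto
    then have "(\<Sum>x | x \<in> P \<and> distinct (map K (x # xs)). ?g (x # xs))
        = (\<Sum>x | x \<in> P \<and> K x \<notin> K ` set xs. wt x) * ?g xs"
      by (simp add: sum_distrib_right)
    then show "(\<Sum>x | x \<in> P \<and> distinct (map K (x # xs)). ?g (x # xs)) = ?g xs * (real ?W - real k)"
      using inner[OF xs] by simp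
  qed
  also have "\<dots> = fact k * real (?W choose k) * (real ?W - real k)"
    using Suc.IH by (simp add: wt_def sum_distrib_right[symmetric])
  also have "\<dots> = fact (Suc k) * real (?W choose Suc k)"
  proof (cases "k \<le> ?W")
    case True
    have "Suc k * (?W choose Suc k) = (?W choose k) * (?W - k)"
      using binomial_absorb_comp[of ?W k] binomial_absorption[of k ?W] True
      by (metis Suc_times_binomial_add binomial_absorption mult.commute)
    then have "real (Suc k) * real (?W choose Suc k) = real (?W choose k) * (real ?W - real k)"
      using True by (metis of_nat_diff of_nat_mult)
    then show ?thesis by (simp only: fact_Suc mult.assoc) (metis mult.left_commute)
  qed (simp add: binomial_eq_0)
  finally show ?case by (simp add: wt_def)
qed

section \<open>Cycles, shifts and temporal periods\<close>

text \<open>\<open>\<sigma> div gcd s \<sigma>\<close> is the order of \<open>s\<close> modulo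
  \<sigma>. One turn through \<open>l\<close> classes rotates the word by \<open>s\<close>, and this
  many turns bring the word itself back; for \<open>s = 0\<close> the gcd is \<sigma> and one turn
  suffices.\<close>

definition cycle_period :: "nat \<Rightarrow> nat \<Rightarrow> nat \<Rightarrow> nat" where
  "cycle_period \<sigma> l s = l * (\<sigma> div gcd s \<sigma>)"

text \<open>The images a rule must assign to the entries of \<open>b\<close> to make it a cycle,
  which closes up only modulo rotation.\<close>

definition cycle_step :: "nat list list \<Rightarrow> nat \<Rightarrow> nat list list" where
  "cycle_step b s = tl b @ [rotate s (hd b)]"

text \<open>
  Cycles modulo rotation, with marked starting word \<^term>\<open>hd b\<close>; one turn around the cycle rotates
  it by \<open>s\<close>.
\<close>

definition cycles :: "nat \<Rightarrow> nat \<Rightarrow> nat \<Rightarrow> (nat list \<Rightarrow> nat) \<Rightarrow> (nat list list \<times> nat) set" where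
  "cycles r \<sigma> n f = {(b, s). b \<noteq> [] \<and> b \<in> free_lists n \<sigma> (length b) \<and> s < \<sigma> \<and>
     map (word_step r f) b = cycle_step b s}"

lemma cycle_funpow:
  assumes "map (word_step r f) b = cycle_step b s" "j < length b"
  shows "(word_step r f ^^ j) (hd b) = b ! j"
  using assms(2)
proof (induction j)
  case (Suc j)
  have "word_step r f (b ! j) = map (word_step r f) b ! j" using Suc.prems by simp
  also have "\<dots> = b ! Suc j" using Suc.prems assms(1) by (simp add: cycle_step_def nth_append nth_tl less_diff_conv)
  finally show ?case using Suc by simp
qed (simp add: hd_conv_nth)

lemma cycle_funpow_length:
  assumes "map (word_step r f) b = cycle_step b s" "b \<noteq> []"
  shows "(word_step r f ^^ length b) (hd b) = rotate s (hd b)"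
proof -
  obtain l where l: "length b = Suc l" using assms(2) by (cases b) auto
  have "(word_step r f ^^ length b) (hd b) = word_step r f (b ! l)"
    using cycle_funpow[OF assms(1), of l] l by simp
  also have "\<dots> = map (word_step r f) b ! l" using l by simp
  also have "\<dots> = rotate s (hd b)" using l assms(1) by (simp add: cycle_step_def nth_append)
  finally show ?thesis .
qed

lemma cycle_funpow_mult:
  assumes "map (word_step r f) b = cycle_step b s" "b \<noteq> []" "j < length b"
  shows "(word_step r f ^^ (q * length b + j)) (hd b) = rotate (q * s) (b ! j)"
proof -
  have "(word_step r f ^^ (q * length b)) (hd b) = rotate (q * s) (hd b)"
  proof (induction q)
    case (Suc q)
    have "(word_step r f ^^ (Suc q * length b)) (hd b)
        = (word_step r f ^^ (q * length b)) ((word_step r f ^^ length b) (hd b))"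
      by (metis add.commute comp_apply funpow_add mult_Suc)
    then show ?case
      using Suc assms by (simp add: cycle_funpow_length word_step_funpow_rotate rotate_rotate)
  qed simp
  then show ?thesis
    using cycle_funpow[OF assms(1,3)]
    by (simp add: add.commute[of "q * length b"] funpow_add word_step_funpow_rotate)
qed

lemma periodic_solution_iff:
  assumes "L \<noteq> []"
  shows "periodic_solution r f L \<tau> \<longleftrightarrow> primitive_word L \<and> \<tau> \<ge> 1 \<and> (word_step r f ^^ \<tau>) L = L \<and>
     (\<forall>t. 0 < t \<and> t < \<tau> \<longrightarrow> (word_step r f ^^ t) L \<noteq> L)"
proof -
  have "trajectory r f (repeat_word L) t = repeat_word L \<longleftrightarrow> (word_step r f ^^ t) L = L" for t
    unfolding trajectory_repeat_word[OF assms] using repeat_word_inject by fastforce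
  then show ?thesis unfolding periodic_solution_def by simp
qed

lemma periodic_solution_unique:
  "periodic_solution r f L \<tau> \<Longrightarrow> periodic_solution r f L \<tau>' \<Longrightarrow> \<tau> = \<tau>'"
  unfolding periodic_solution_def by (metis less_le_trans linorder_neqE_nat zero_less_one)

lemma primitive_of_funpow: "primitive_word ((word_step r f ^^ t) L) \<Longrightarrow> L \<noteq> [] \<Longrightarrow> primitive_word L"
proof (induction t)
  case (Suc t)
  have "(word_step r f ^^ t) L \<noteq> []" using Suc.prems(2) by (metis length_0_conv length_word_step_funpow)
  then show ?case using Suc primitive_word_of_step[of r f "(word_step r f ^^ t) L"] by simp
qed simp

lemma funpow_period_mult:
  assumes "(word_step r f ^^ \<tau>) v = v"
  shows "(word_step r f ^^ (\<tau> * j)) v = v"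
proof (induction j)
  case (Suc j)
  have "(word_step r f ^^ (\<tau> * Suc j)) v = (word_step r f ^^ \<tau>) ((word_step r f ^^ (\<tau> * j)) v)" by (simp add: funpow_add)
  then show ?case using Suc assms by simp
qed simp

lemma funpow_orb: "u \<in> orb v \<Longrightarrow> (word_step r f ^^ t) u \<in> orb ((word_step r f ^^ t) v)"
  by (auto simp: orb_def word_step_funpow_rotate)

context
  fixes r \<sigma> n :: nat and f :: "nat list \<Rightarrow> nat"
  assumes pos: "\<sigma> > 0"
begin

private abbreviation F where "F \<equiv> word_step r f"

lemma pword_nonempty: "L \<in> pwords n \<sigma> \<Longrightarrow> L \<noteq> []"
  using pos pwordsD(1) by fastforce

lemma cycles_props:
  assumes "(b, s) \<in> cycles r \<sigma> n f"
  shows "b \<noteq> []" "set b \<subseteq> pwords n \<sigma>" "distinct (map orb b)" "s < \<sigma>"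
    "map F b = cycle_step b s" "hd b \<in> pwords n \<sigma>"
  using assms hd_in_set[of b] by (auto simp: cycles_def free_lists_def)

text \<open>The entries of \<open>b\<close> lie in different rotation classes, so the class of the
  start recurs exactly at the multiples of the length.\<close>

lemma cycle_orb_index:
  assumes "(b, s) \<in> cycles r \<sigma> n f" "j < length b"
  shows "(F ^^ (q * length b + j)) (hd b) \<in> orb (hd b) \<longleftrightarrow> j = 0"
proof -
  note c = cycles_props[OF assms(1)]
  have "(F ^^ (q * length b + j)) (hd b) \<in> orb (hd b) \<longleftrightarrow> orb (b ! j) = orb (b ! 0)"
    unfolding cycle_funpow_mult[OF c(5,1) assms(2)] orb_eq_iff[symmetric]
    by (simp add: hd_conv_nth[OF c(1)])
  also have "\<dots> \<longleftrightarrow> map orb b ! j = map orb b ! 0" using c assms(2) by simp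
  also have "\<dots> \<longleftrightarrow> j = 0"
    using c assms(2) by (subst nth_eq_iff_index_eq) auto
  finally show ?thesis .
qed

text \<open>A return of the word is a return of its class, hence happens at a time
  \<open>q * length b\<close>. The accumulated rotation by \<open>q * s\<close> is trivial iff
  \<sigma> divides \<open>q * s\<close>, that is, iff the order of \<open>s\<close> divides
  \<open>q\<close>.\<close>

lemma periodic_solution_cycle:
  assumes "(b, s) \<in> cycles r \<sigma> n f"
  shows "periodic_solution r f (hd b) (cycle_period \<sigma> (length b) s)"
proof -
  note c = cycles_props[OF assms]
  let ?v = "hd b" and ?l = "length b" and ?o = "\<sigma> div gcd s \<sigma>"
  have v: "?v \<noteq> []" "primitive_word ?v" "length ?v = \<sigma>"
    using c(6) pword_nonempty pwordsD by auto
  have l: "0 < ?l" using c(1) by simp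
  have g: "gcd s \<sigma> > 0" using pos by simp
  have o: "0 < ?o" using pos g by (simp add: div_greater_zero_iff dvd_imp_le)
  have mult: "(F ^^ (q * ?l)) ?v = rotate (q * s) ?v" for q
    using cycle_funpow_mult[OF c(5) c(1), of 0 q] l by (simp add: hd_conv_nth[OF c(1)])
  have "\<sigma> dvd ?o * s"
    by (metis dvd_div_mult dvd_triv_left gcd_dvd1 gcd_dvd2 div_mult_swap mult.commute)
  then have "(F ^^ (cycle_period \<sigma> ?l s)) ?v = ?v"
    using mult[of ?o] v by (simp add: cycle_period_def mult.commute rotate_eq_self_iff)
  moreover have "(F ^^ t) ?v \<noteq> ?v" if t: "0 < t" "t < cycle_period \<sigma> ?l s" for t
  proof
    assume eq: "(F ^^ t) ?v = ?v"
    define q j where "q = t div ?l" and "j = t mod ?l"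
    have tq: "t = q * ?l + j" and j: "j < ?l" using l by (simp_all add: q_def j_def)
    have "j = 0" using cycle_orb_index[OF assms j, of q] eq tq by simp
    then have "rotate (q * s) ?v = ?v" using mult eq tq by simp
    then have "\<sigma> dvd q * s" using rotate_eq_self_iff[OF v(2,1)] v(3) by simp
    then have "?o dvd q * (s div gcd s \<sigma>)"
      using g by (metis div_dvd_div dvd_div_mult dvd_mult gcd_dvd1 gcd_dvd2 div_mult_swap)
    moreover have "coprime ?o (s div gcd s \<sigma>)"
      using div_gcd_coprime[of s \<sigma>] g pos by (simp add: coprime_commute)
    ultimately have "?o dvd q" by (simp add: coprime_dvd_mult_left_iff)
    moreover have "q > 0" using t tq \<open>j = 0\<close> by (cases q) auto
    ultimately have "?o \<le> q" by (rule dvd_imp_le)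
    then show False using t tq \<open>j = 0\<close> l unfolding cycle_period_def
      by (metis add.right_neutral linorder_not_less mult.commute mult_le_mono1)
  qed
  moreover have "cycle_period \<sigma> ?l s \<ge> 1" using l o by (simp add: cycle_period_def Suc_leI)
  ultimately show ?thesis using v by (simp add: periodic_solution_iff)
qed

text \<open>The entries are iterates of the start, the length is its first return time to its own
  class, and primitivity makes the rotation at that time unique below \<sigma>.\<close>

lemma cycle_unique:
  assumes "(b, s) \<in> cycles r \<sigma> n f" "(b', s') \<in> cycles r \<sigma> n f" "hd b = hd b'"
  shows "b = b' \<and> s = s'"
proof -
  note c = cycles_props[OF assms(1)] and c' = cycles_props[OF assms(2)]
  have not_less: "\<not> length b' < length b"
    if "(b, s) \<in> cycles r \<sigma> n f" "(b', s') \<in> cycles r \<sigma> n f" "hd b = hd b'" for b s b' s'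
  proof
    assume "length b' < length b"
    moreover have "(F ^^ length b') (hd b) \<in> orb (hd b)"
      using cycle_funpow_length[OF cycles_props(5,1)[OF that(2)]] that(3) by simp
    ultimately show False
      using cycle_orb_index[OF that(1), of "length b'" 0] cycles_props(1)[OF that(2)] by simp
  qed
  have len: "length b = length b'"
    using not_less[OF assms] not_less[OF assms(2,1) assms(3)[symmetric]] by simp
  have "b = b'"
    using len cycle_funpow[OF c(5)] cycle_funpow[OF c'(5)] assms(3) by (metis nth_equalityI)
  have v: "hd b \<noteq> []" "primitive_word (hd b)" "length (hd b) = \<sigma>"
    using c(6) pword_nonempty pwordsD by auto
  have "rotate s (hd b) = rotate s' (hd b)"
    using cycle_funpow_length[OF c(5,1)] cycle_funpow_length[OF c'(5,1)] len assms(3) by simp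
  then have "s = s'" using rotate_eq_rotate_iff[OF v(2,1)] v(3) c(4) c'(4) by simp
  with \<open>b = b'\<close> show ?thesis by simp
qed

end

context
  fixes r \<sigma> n :: nat and f :: "nat list \<Rightarrow> nat"
  assumes pos: "\<sigma> > 0" and f: "f \<in> rules r n"
begin

lemma word_step_in_words:
  assumes "L \<in> words n \<sigma>"
  shows "word_step r f L \<in> words n \<sigma>"
proof -
  have "f (window r L x) < n" for x
    using window_in_words[OF assms pos] f by (auto simp: rules_def)
  then show ?thesis using assms by (auto simp: word_step_def words_def)
qed

lemma funpow_in_words: "L \<in> words n \<sigma> \<Longrightarrow> (word_step r f ^^ t) L \<in> words n \<sigma>"
  by (induction t) (simp_all add: word_step_in_words)

text \<open>The length \<open>l\<close> is the first return time of \<open>v\<close> to its rotation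
  class, which may be earlier than its temporal period; the shift is the rotation found at that
  return.\<close>

lemma cycle_exists:
  assumes v: "v \<in> words n \<sigma>" and ps: "periodic_solution r f v \<tau>"
  shows "\<exists>b s. (b, s) \<in> cycles r \<sigma> n f \<and> hd b = v"
proof -
  have ne: "v \<noteq> []" using v pos by (auto simp: words_def)
  have \<tau>: "\<tau> \<ge> 1" "(word_step r f ^^ \<tau>) v = v" and prim: "primitive_word v"
    using ps by (simp_all add: periodic_solution_iff[OF ne])
  define l where "l = (LEAST l. 1 \<le> l \<and> (word_step r f ^^ l) v \<in> orb v)"
  have l: "1 \<le> l" "(word_step r f ^^ l) v \<in> orb v"
    using LeastI[of "\<lambda>l. 1 \<le> l \<and> (word_step r f ^^ l) v \<in> orb v" \<tau>] \<tau> unfolding l_def by auto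
  have l_least: "l \<le> j" if "1 \<le> j" "(word_step r f ^^ j) v \<in> orb v" for j
    unfolding l_def using that by (intro Least_le) simp
  have mult: "(word_step r f ^^ (l * q)) v \<in> orb v" for q
  proof (induction q)
    case (Suc q)
    have "(word_step r f ^^ (l * Suc q)) v = (word_step r f ^^ l) ((word_step r f ^^ (l * q)) v)" by (simp add: funpow_add)
    then show ?case using funpow_orb[OF Suc, of l] l(2) orb_trans by metis
  qed simp
  have dvd: "l dvd t" if "(word_step r f ^^ t) v \<in> orb v" for t
  proof -
    have "(word_step r f ^^ t) v = (word_step r f ^^ (t mod l)) ((word_step r f ^^ (l * (t div l))) v)"
      by (metis comp_apply funpow_add mod_mult_div_eq)
    also have "\<dots> \<in> orb ((word_step r f ^^ (t mod l)) v)" by (rule funpow_orb[OF mult])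
    finally have "(word_step r f ^^ (t mod l)) v \<in> orb v" using that orb_sym orb_trans by blast
    then have "\<not> 1 \<le> t mod l" using l_least[of "t mod l"] l(1) by (metis linorder_not_less mod_less_divisor less_le_trans zero_less_one)
    then show ?thesis by (simp add: dvd_eq_mod_eq_0)
  qed
  obtain s0 where s0: "(word_step r f ^^ l) v = rotate s0 v" using l(2) by (auto simp: orb_def)
  define s where "s = s0 mod \<sigma>"
  have len: "length v = \<sigma>" using v by (simp add: words_def)
  have s: "(word_step r f ^^ l) v = rotate s v" "s < \<sigma>"
    using s0 pos len by (auto simp: s_def simp flip: rotate_conv_mod)
  define b where "b = map (\<lambda>j. (word_step r f ^^ j) v) [0..<l]"
  \<comment> \<open>Every iterate leads back to the primitive word \<open>v\<close> after
    \<open>\<tau> * j - j\<close> further steps, which only a primitive word can do.\<close>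
  have "(word_step r f ^^ j) v \<in> pwords n \<sigma>" for j
  proof -
    have j: "j \<le> \<tau> * j" using \<tau> by simp
    have "(word_step r f ^^ (\<tau> * j - j)) ((word_step r f ^^ j) v) = (word_step r f ^^ (\<tau> * j)) v"
      using j by (metis comp_apply funpow_add le_add_diff_inverse2)
    also have "\<dots> = v" by (rule funpow_period_mult[OF \<tau>(2)])
    finally have "primitive_word ((word_step r f ^^ (\<tau> * j - j)) ((word_step r f ^^ j) v))" using prim by simp
    moreover have "(word_step r f ^^ j) v \<noteq> []" using ne by (metis length_0_conv length_word_step_funpow)
    ultimately show ?thesis
      using primitive_of_funpow funpow_in_words[OF v] by (auto simp: pwords_def)
  qed
  moreover have "distinct (map orb b)"
  proof -
    \<comment> \<open>A coincidence at times \<open>i < j\<close> is carried forward to the multiple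
      \<open>\<tau> * j\<close> of the period. It yields returns to the class at two times that
      differ by \<open>j - i\<close>, and \<open>l\<close> cannot divide this smaller
      number.\<close>
    have "orb ((word_step r f ^^ i) v) \<noteq> orb ((word_step r f ^^ j) v)" if ij: "i < j" "j < l" for i j
    proof
      assume "orb ((word_step r f ^^ i) v) = orb ((word_step r f ^^ j) v)"
      then have *: "(word_step r f ^^ i) v \<in> orb ((word_step r f ^^ j) v)" using orb_self by blast
      have j: "j \<le> \<tau> * j" using \<tau> by simp
      have "(word_step r f ^^ (\<tau> * j - j)) ((word_step r f ^^ i) v) \<in> orb ((word_step r f ^^ (\<tau> * j - j)) ((word_step r f ^^ j) v))"
        by (rule funpow_orb[OF *])
      also have "(word_step r f ^^ (\<tau> * j - j)) ((word_step r f ^^ j) v) = (word_step r f ^^ (\<tau> * j)) v"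
        using j by (metis comp_apply funpow_add le_add_diff_inverse2)
      also have "\<dots> = v" by (rule funpow_period_mult[OF \<tau>(2)])
      finally have "(word_step r f ^^ (\<tau> * j - j + i)) v \<in> orb v" by (simp add: funpow_add)
      then have "l dvd \<tau> * j - j + i" by (rule dvd)
      moreover have "l dvd \<tau> * j" by (rule dvd) (simp add: funpow_period_mult[OF \<tau>(2)])
      moreover have "\<tau> * j = (\<tau> * j - j + i) + (j - i)" using j ij by linarith
      ultimately have "l dvd j - i" by (metis dvd_add_right_iff)
      then show False using ij by (auto dest: dvd_imp_le)
    qed
    then show ?thesis
      unfolding b_def by (auto simp: distinct_map inj_on_def) (metis linorder_neqE_nat)+
  qed
  moreover have "map (word_step r f) b = cycle_step b s"
  proof (rule nth_equalityI)
    show "length (map (word_step r f) b) = length (cycle_step b s)" using l by (simp add: b_def cycle_step_def)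
    fix j assume "j < length (map (word_step r f) b)"
    then have j: "j < l" by (simp add: b_def)
    have hd: "hd b = v" using l by (simp add: b_def hd_map upt_rec)
    have "word_step r f ((word_step r f ^^ j) v) = (word_step r f ^^ Suc j) v" by simp
    then show "map (word_step r f) b ! j = cycle_step b s ! j"
      using j s(1) hd by (cases "Suc j = l") (auto simp: b_def cycle_step_def nth_append nth_tl)
  qed
  moreover have "hd b = v" "b \<noteq> []" using l by (simp_all add: b_def hd_map upt_rec)
  ultimately have "(b, s) \<in> cycles r \<sigma> n f \<and> hd b = v"
    using s(2) by (auto simp: cycles_def free_lists_def b_def)
  then show ?thesis by blast
qed

end

section \<open>Counting long cycles by marked cycles\<close>

definition long_cycles :: "nat \<Rightarrow> nat \<Rightarrow> nat \<Rightarrow> real \<Rightarrow> (nat list \<Rightarrow> nat) \<Rightarrow> (nat list list \<times> nat) set" where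
  "long_cycles r \<sigma> n \<theta> f = {(b, s) \<in> cycles r \<sigma> n f. \<theta> < real (cycle_period \<sigma> (length b) s)}"

definition long_words :: "nat \<Rightarrow> nat \<Rightarrow> nat \<Rightarrow> real \<Rightarrow> (nat list \<Rightarrow> nat) \<Rightarrow> nat list set" where
  "long_words r \<sigma> n \<theta> f = {v \<in> pwords n \<sigma>. \<exists>\<tau>. periodic_solution r f v \<tau> \<and> \<theta> < real \<tau>}"

text \<open>For a periodic word this is an equivalence class: all rotations of all words on its
  cycle.\<close>

definition step_class :: "nat \<Rightarrow> (nat list \<Rightarrow> nat) \<Rightarrow> nat list \<Rightarrow> nat list set" where
  "step_class r f v = (\<Union>t. orb ((word_step r f ^^ t) v))"

text \<open>The count \<open>W\<close> of the overview, independent of any choice of starting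
  words.\<close>

definition num_long_cycles :: "nat \<Rightarrow> nat \<Rightarrow> nat \<Rightarrow> real \<Rightarrow> (nat list \<Rightarrow> nat) \<Rightarrow> nat" where
  "num_long_cycles r \<sigma> n \<theta> f = card (step_class r f ` long_words r \<sigma> n \<theta> f)"

text \<open>A cycle through \<open>l\<close> classes contains \<open>\<sigma> * l\<close> words,
  each of which can be marked as its start; the weight divides this choice out.\<close>

definition cycle_weight :: "nat \<Rightarrow> (nat list list \<times> nat) list \<Rightarrow> real" where
  "cycle_weight \<sigma> cs = (\<Prod>c\<leftarrow>cs. 1 / real (\<sigma> * length (fst c)))"

lemma finite_long_words [simp]: "finite (long_words r \<sigma> n \<theta> f)"
  by (rule finite_subset[OF _ finite_pwords[of n \<sigma>]]) (auto simp: long_words_def)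

lemma card_pwords_le: "card (pwords n \<sigma>) \<le> n ^ \<sigma>"
proof -
  have "card (pwords n \<sigma>) \<le> card (words n \<sigma>)"
    by (rule card_mono) (auto simp: pwords_def finite_words)
  then show ?thesis by (simp add: card_words)
qed

lemma free_lists_length_le: "u \<in> free_lists n \<sigma> m \<Longrightarrow> m \<le> n ^ \<sigma>"
proof -
  assume u: "u \<in> free_lists n \<sigma> m"
  then have "m = card (set u)" using distinct_card[of u] by (auto simp: free_lists_def distinct_map)
  also have "\<dots> \<le> card (pwords n \<sigma>)" using u by (intro card_mono) (auto simp: free_lists_def)
  finally show ?thesis using card_pwords_le by (rule le_trans)
qed

lemma cycles_subset:
  "cycles r \<sigma> n f \<subseteq> (\<Union>m\<in>{..n ^ \<sigma>}. free_lists n \<sigma> m) \<times> {..<\<sigma>}"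
  unfolding cycles_def using free_lists_length_le by fastforce

lemma finite_long_cycles [simp]: "finite (long_cycles r \<sigma> n \<theta> f)"
  by (rule finite_subset[OF _ finite_subset[OF cycles_subset]]) (auto simp: long_cycles_def)

lemma step_class_trans: "u \<in> step_class r f v \<Longrightarrow> step_class r f u \<subseteq> step_class r f v"
proof
  fix x assume u: "u \<in> step_class r f v" and x: "x \<in> step_class r f u"
  obtain t where t: "u \<in> orb ((word_step r f ^^ t) v)" using u by (auto simp: step_class_def)
  obtain t' where t': "x \<in> orb ((word_step r f ^^ t') u)" using x by (auto simp: step_class_def)
  have "(word_step r f ^^ t') u \<in> orb ((word_step r f ^^ (t' + t)) v)"
    using funpow_orb[OF t, of t'] by (simp add: funpow_add)
  then show "x \<in> step_class r f v" using t' orb_trans unfolding step_class_def by blast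
qed

lemma step_class_self: "v \<in> step_class r f v"
  unfolding step_class_def by (metis UNIV_I UN_I funpow_0 orb_self)

text \<open>Continuing from time \<open>t\<close> to the multiple \<open>\<tau> * t\<close> of the
  period leads back to \<open>v\<close>.\<close>

lemma step_class_sym:
  assumes "u \<in> step_class r f v" "(word_step r f ^^ \<tau>) v = v" "\<tau> \<ge> 1"
  shows "v \<in> step_class r f u"
proof -
  obtain t where t: "u \<in> orb ((word_step r f ^^ t) v)" using assms(1) by (auto simp: step_class_def)
  have tt: "t \<le> \<tau> * t" using assms(3) by simp
  have "(word_step r f ^^ (\<tau> * t - t)) u \<in> orb ((word_step r f ^^ (\<tau> * t - t)) ((word_step r f ^^ t) v))"
    by (rule funpow_orb[OF t])
  also have "(word_step r f ^^ (\<tau> * t - t)) ((word_step r f ^^ t) v) = (word_step r f ^^ (\<tau> * t)) v"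
    using tt by (metis comp_apply funpow_add le_add_diff_inverse2)
  also have "\<dots> = v" by (rule funpow_period_mult[OF assms(2)])
  finally show ?thesis unfolding step_class_def using orb_sym by blast
qed

lemma step_class_funpow:
  assumes "u \<in> step_class r f v" "(word_step r f ^^ t) v = v"
  shows "(word_step r f ^^ t) u = u"
proof -
  obtain i j where u: "u = rotate i ((word_step r f ^^ j) v)" using assms(1) by (auto simp: step_class_def orb_def)
  have "(word_step r f ^^ t) ((word_step r f ^^ j) v) = (word_step r f ^^ j) ((word_step r f ^^ t) v)"
    by (metis add.commute comp_apply funpow_add)
  then show ?thesis using u assms(2) by (simp add: word_step_funpow_rotate)
qed

context
  fixes r \<sigma> n :: nat and f :: "nat list \<Rightarrow> nat" and \<theta> :: real
  assumes pos: "\<sigma> > 0" and f: "f \<in> rules r n"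
begin

private abbreviation P where "P \<equiv> long_words r \<sigma> n \<theta> f"
private abbreviation C where "C \<equiv> long_cycles r \<sigma> n \<theta> f"
private abbreviation K where "K \<equiv> step_class r f"

lemma long_words_ps:
  assumes "v \<in> P"
  obtains \<tau> where "periodic_solution r f v \<tau>" "\<tau> \<ge> 1" "(word_step r f ^^ \<tau>) v = v" "\<theta> < real \<tau>" "v \<in> pwords n \<sigma>"
proof -
  have "v \<in> pwords n \<sigma>" using assms by (simp add: long_words_def)
  then show ?thesis
    using assms that pword_nonempty[OF pos] periodic_solution_iff[of v r f]
    by (auto simp: long_words_def)
qed

lemma step_class_in_long_words:
  assumes v: "v \<in> P" and u: "u \<in> K v"
  shows "u \<in> P" and "K u = K v"
proof -
  obtain \<tau> where \<tau>: "periodic_solution r f v \<tau>" "\<tau> \<ge> 1" "(word_step r f ^^ \<tau>) v = v" "\<theta> < real \<tau>" "v \<in> pwords n \<sigma>"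
    using long_words_ps[OF v] .
  have vu: "v \<in> K u" by (rule step_class_sym[OF u \<tau>(3,2)])
  show "K u = K v" using step_class_trans u vu by blast
  have len: "length u = \<sigma>" "u \<noteq> []"
  proof -
    show "length u = \<sigma>" using u pwordsD(1)[OF \<tau>(5)] by (auto simp: step_class_def orb_def)
    then show "u \<noteq> []" using pos by auto
  qed
  obtain i' j' where "u = rotate i' ((word_step r f ^^ j') v)" using u by (auto simp: step_class_def orb_def)
  then have uw: "u \<in> words n \<sigma>"
    using funpow_in_words[OF pos f pwordsD(3)[OF \<tau>(5)], of j'] by (simp add: words_def)
  obtain i j where v_eq: "v = rotate i ((word_step r f ^^ j) u)" using vu by (auto simp: step_class_def orb_def)
  have ne: "(word_step r f ^^ j) u \<noteq> []" using len(2) by (metis length_0_conv length_word_step_funpow)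
  have "primitive_word ((word_step r f ^^ j) u)"
    using pwordsD(2)[OF \<tau>(5)] primitive_word_rotate[OF ne] unfolding v_eq by simp
  then have prim: "primitive_word u" using primitive_of_funpow[OF _ len(2)] by blast
  have "(word_step r f ^^ t) u = u \<longleftrightarrow> (word_step r f ^^ t) v = v" for t
    using step_class_funpow[OF u] step_class_funpow[OF vu] by blast
  then have "periodic_solution r f u \<tau>"
    using \<tau>(1) prim periodic_solution_iff[OF len(2)] periodic_solution_iff[OF pword_nonempty[OF pos \<tau>(5)]]
    by simp
  then show "u \<in> P" using \<tau>(4) prim uw by (auto simp: long_words_def pwords_def)
qed

lemma step_class_fibre: "v \<in> P \<Longrightarrow> {u \<in> P. K u = K v} = K v"
  using step_class_in_long_words step_class_self by blast

lemma step_class_cycle: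
  assumes "(b, s) \<in> cycles r \<sigma> n f"
  shows "K (hd b) = (\<Union>w\<in>set b. orb w)"
proof -
  note c = cycles_props[OF pos assms]
  show ?thesis
  proof (intro equalityI subsetI)
    fix x assume "x \<in> K (hd b)"
    then obtain t where t: "x \<in> orb ((word_step r f ^^ t) (hd b))" by (auto simp: step_class_def)
    define q j where "q = t div length b" and "j = t mod length b"
    have j: "j < length b" "t = q * length b + j" using c(1) by (simp_all add: q_def j_def)
    have "x \<in> orb (b ! j)"
      using t cycle_funpow_mult[OF c(5,1) j(1), of q] j(2) by simp
    then show "x \<in> (\<Union>w\<in>set b. orb w)" using j(1) by auto
  next
    fix x assume "x \<in> (\<Union>w\<in>set b. orb w)"
    then obtain j where "j < length b" "x \<in> orb (b ! j)" by (auto simp: in_set_conv_nth)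
    then have "x \<in> orb ((word_step r f ^^ j) (hd b))" using cycle_funpow[OF c(5)] by simp
    then show "x \<in> K (hd b)" by (auto simp: step_class_def)
  qed
qed

lemma long_cycles_hd:
  assumes "(b, s) \<in> C"
  shows "hd b \<in> P" "card {u \<in> P. K u = K (hd b)} = \<sigma> * length b"
proof -
  have c: "(b, s) \<in> cycles r \<sigma> n f" using assms by (simp add: long_cycles_def)
  show v: "hd b \<in> P"
    using cycles_props(6)[OF pos c] periodic_solution_cycle[OF pos c] assms
    by (auto simp: long_words_def long_cycles_def)
  have "b \<in> free_lists n \<sigma> (length b)" using c by (simp add: cycles_def)
  then show "card {u \<in> P. K u = K (hd b)} = \<sigma> * length b"
    by (subst step_class_fibre[OF v], subst step_class_cycle[OF c]) (simp add: card_UN_orb[OF pos] mult.commute)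
qed

text \<open>A periodic word starts exactly one marked cycle, and the period read off from that cycle
  is the minimal one, so the threshold selects the same objects on both sides.\<close>

lemma bij_betw_long_cycles: "bij_betw (hd \<circ> fst) C P"
proof (rule bij_betw_imageI)
  show "inj_on (hd \<circ> fst) C"
    using cycle_unique[OF pos] by (auto simp: inj_on_def long_cycles_def)
  show "(hd \<circ> fst) ` C = P"
  proof (intro equalityI subsetI)
    fix v assume v: "v \<in> P"
    obtain \<tau> where \<tau>: "periodic_solution r f v \<tau>" "\<theta> < real \<tau>" "v \<in> pwords n \<sigma>"
      using long_words_ps[OF v] by metis
    obtain b s where bs: "(b, s) \<in> cycles r \<sigma> n f" "hd b = v"
      using cycle_exists[OF pos f pwordsD(3)[OF \<tau>(3)] \<tau>(1)] by blast
    have "cycle_period \<sigma> (length b) s = \<tau>"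
      using periodic_solution_cycle[OF pos bs(1)] \<tau>(1) bs(2) periodic_solution_unique by blast
    then have "(b, s) \<in> C" using bs \<tau> by (simp add: long_cycles_def)
    then show "v \<in> (hd \<circ> fst) ` C" using bs(2) by force
  qed (use long_cycles_hd in auto)
qed

text \<open>Two cycles that share a rotation class have the same \<open>step_class\<close>.
  Distinctness of cycles thus becomes the free-list condition on all their words together, under
  which the images are independent.\<close>

lemma distinct_orb_concat_iff:
  "set cs \<subseteq> C \<Longrightarrow> distinct (map orb (concat (map fst cs))) \<longleftrightarrow> distinct (map (K \<circ> hd \<circ> fst) cs)"
proof (induction cs)
  case (Cons c cs)
  obtain b s where c: "c = (b, s)" "(b, s) \<in> C" using Cons.prems by (cases c) auto
  then have cyc: "(b, s) \<in> cycles r \<sigma> n f" by (simp add: long_cycles_def)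
  have b: "b \<noteq> []" "distinct (map orb b)" using cycles_props[OF pos cyc] by auto
  have "orb ` set b \<inter> orb ` set (concat (map fst cs)) = {} \<longleftrightarrow> K (hd b) \<notin> (\<lambda>c. K (hd (fst c))) ` set cs"
    (is "?L \<longleftrightarrow> ?R")
  proof
    assume L: ?L
    show ?R
    proof
      assume "K (hd b) \<in> (\<lambda>c. K (hd (fst c))) ` set cs"
      then obtain b' s' where c': "(b', s') \<in> set cs" "K (hd b) = K (hd b')" by auto
      then have cyc': "(b', s') \<in> cycles r \<sigma> n f" using Cons.prems by (auto simp: long_cycles_def)
      have "hd b \<in> (\<Union>w\<in>set b'. orb w)"
        using step_class_self[of "hd b" r f] unfolding c'(2) step_class_cycle[OF cyc'] .
      then obtain w where "w \<in> set b'" "orb (hd b) = orb w" using orb_eqI by blast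
      then have "orb (hd b) \<in> orb ` set (concat (map fst cs))" using c'(1) by force
      moreover have "orb (hd b) \<in> orb ` set b" using b(1) by simp
      ultimately show False using L by blast
    qed
  next
    assume R: ?R
    show ?L
    proof (rule ccontr)
      assume "\<not> ?L"
      then obtain w w' b' s' where w: "w \<in> set b" "(b', s') \<in> set cs" "w' \<in> set b'" "orb w = orb w'"
        by fastforce
      have c': "(b', s') \<in> C" using w(2) Cons.prems by auto
      then have cyc': "(b', s') \<in> cycles r \<sigma> n f" by (simp add: long_cycles_def)
      have "w \<in> K (hd b)" "w \<in> K (hd b')"
        using w step_class_cycle[OF cyc] step_class_cycle[OF cyc'] orb_self by blast+
      then have "K (hd b) = K (hd b')"
        using step_class_in_long_words(2) long_cycles_hd(1) c(2) c' by metis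
      then show False using R w(2) by force
    qed
  qed
  then show ?case using Cons b c(1) by (simp add: image_image conj_commute)
qed simp

text \<open>\<open>sum_distinct_classes\<close> carried over from words to marked cycles: the fibre
  of a starting word under \<open>step_class\<close> has exactly the size by which
  \<open>cycle_weight\<close> divides.\<close>

lemma sum_cycle_weight:
  "(\<Sum>cs | length cs = k \<and> set cs \<subseteq> C \<and> distinct (map orb (concat (map fst cs))). cycle_weight \<sigma> cs)
    = fact k * real (num_long_cycles r \<sigma> n \<theta> f choose k)"
proof -
  let ?h = "hd \<circ> fst"
  let ?g = "inv_into C ?h"
  have inj: "inj_on ?h C" and img: "?h ` C = P" using bij_betw_long_cycles by (auto simp: bij_betw_def)
  have gh: "?g (?h c) = c" if "c \<in> C" for c using inj that by (rule inv_into_f_f)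
  have hg: "?h (?g v) = v" "?g v \<in> C" if "v \<in> P" for v
    using that f_inv_into_f[of v ?h C] inv_into_into[of v ?h C] unfolding img by blast+
  have map_gh: "map ?g (map ?h cs) = cs" if "set cs \<subseteq> C" for cs
    using that gh by (induction cs) auto
  have map_hg: "map ?h (map ?g xs) = xs" if "set xs \<subseteq> P" for xs
    using that hg by (induction xs) auto
  have "(\<Sum>cs | length cs = k \<and> set cs \<subseteq> C \<and> distinct (map orb (concat (map fst cs))). cycle_weight \<sigma> cs)
     = (\<Sum>xs | length xs = k \<and> set xs \<subseteq> P \<and> distinct (map K xs).
            \<Prod>x\<leftarrow>xs. 1 / real (card {y \<in> P. K y = K x}))"
  proof (rule sum.reindex_bij_witness[where i = "map ?g" and j = "map ?h"], goal_cases)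
    case (1 cs)
    then show ?case using map_gh by blast
  next
    case (2 cs)
    then have "map ?h cs \<in> {xs. length xs = k \<and> set xs \<subseteq> P}" using img by auto
    moreover have "distinct (map K (map ?h cs))" using 2 distinct_orb_concat_iff[of cs] by (simp add: comp_assoc)
    ultimately show ?case by simp
  next
    case (3 xs)
    then show ?case using map_hg by blast
  next
    case (4 xs)
    have eq: "map ?h (map ?g xs) = xs" using 4 map_hg by blast
    have sub: "set (map ?g xs) \<subseteq> C" using 4 hg(2) by auto
    have "map (K \<circ> hd \<circ> fst) (map ?g xs) = map K (map ?h (map ?g xs))" by simp
    then have "map (K \<circ> hd \<circ> fst) (map ?g xs) = map K xs" unfolding eq .
    then have "distinct (map orb (concat (map fst (map ?g xs))))"
      using 4 by (simp only: distinct_orb_concat_iff[OF sub] mem_Collect_eq)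
    then show ?case using 4 sub by simp
  next
    case (5 cs)
    have "1 / real (card {y \<in> P. K y = K (?h c)}) = 1 / real (\<sigma> * length (fst c))" if "c \<in> set cs" for c
      using 5 that long_cycles_hd(2)[of "fst c" "snd c"] by auto
    then have "map (\<lambda>x. 1 / real (card {y \<in> P. K y = K x})) (map ?h cs) = map (\<lambda>c. 1 / real (\<sigma> * length (fst c))) cs"
      by simp
    then show ?case unfolding cycle_weight_def by presburger
  qed
  also have "\<dots> = fact k * real (num_long_cycles r \<sigma> n \<theta> f choose k)"
    unfolding num_long_cycles_def by (rule sum_distinct_classes) simp
  finally show ?thesis .
qed

text \<open>With \<theta> \<ge> 0, the default value \<open>0\<close> in the absence of periodic
  solutions agrees with there being no long cycle.\<close>

lemma longest_period_gt_iff: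
  assumes "\<theta> \<ge> 0"
  shows "\<theta> < real (longest_period r \<sigma> n f) \<longleftrightarrow> num_long_cycles r \<sigma> n \<theta> f > 0"
proof -
  have "num_long_cycles r \<sigma> n \<theta> f > 0 \<longleftrightarrow> P \<noteq> {}"
    by (simp add: num_long_cycles_def card_gt_0_iff)
  also have "\<dots> \<longleftrightarrow> (\<exists>\<tau>\<in>temporal_periods r \<sigma> n f. \<theta> < real \<tau>)"
  proof -
    have "primitive_word v" if "periodic_solution r f v \<tau>" for v \<tau>
      using that by (simp add: periodic_solution_def)
    then show ?thesis unfolding long_words_def temporal_periods_def pwords_def by blast
  qed
  also have "\<dots> \<longleftrightarrow> \<theta> < real (longest_period r \<sigma> n f)"
  proof (cases "temporal_periods r \<sigma> n f = {}")
    case False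
    have "(\<exists>\<tau>\<in>temporal_periods r \<sigma> n f. \<theta> < real \<tau>) \<longleftrightarrow> \<theta> < real (Max (temporal_periods r \<sigma> n f))"
      using Max_in[OF finite_temporal_periods False] Max_ge[OF finite_temporal_periods]
      by (meson less_le_trans of_nat_le_iff)
    then show ?thesis using False by (simp add: longest_period_def)
  qed (use assms in \<open>simp add: longest_period_def\<close>)
  finally show ?thesis by simp
qed

end

subsection \<open>Factorial moments of the number of long cycles\<close>

text \<open>
  The fraction of lists of \<open>m\<close> words that are primitive and from distinct rotation classes; truncated
  subtraction makes it vanish once the classes are exhausted.
\<close>

definition survival :: "nat \<Rightarrow> nat \<Rightarrow> nat \<Rightarrow> nat \<Rightarrow> real" where
  "survival \<sigma> a N m = (\<Prod>j<m. real (a - j * \<sigma>) / real N)"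

definition long_shifts :: "nat \<Rightarrow> real \<Rightarrow> nat \<Rightarrow> nat set" where
  "long_shifts \<sigma> \<theta> l = {s. s < \<sigma> \<and> \<theta> < real (cycle_period \<sigma> l s)}"

lemma finite_long_shifts [simp]: "finite (long_shifts \<sigma> \<theta> l)"
  by (simp add: long_shifts_def)

text \<open>All admissible shifts of a cycle of \<open>l\<close> classes contribute equally; their
  number is merged with the factor that \<open>cycle_weight\<close> assigns to the cycle.\<close>

definition length_weight :: "nat \<Rightarrow> real \<Rightarrow> nat \<Rightarrow> real" where
  "length_weight \<sigma> \<theta> l = real (card (long_shifts \<sigma> \<theta> l)) / real (\<sigma> * l)"

text \<open>The sum runs over the lengths of \<open>k\<close> cycles, and \<open>m\<close> counts
  the words placed so far, so that only the total number of words enters \<open>survival\<close>.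
  The factorial moment is the case \<open>m = 0\<close>. The parameters \<open>a\<close> and
  \<open>N\<close> stand for the numbers of primitive and of all words, which detaches the analysis
  from the automaton.\<close>

primrec moment :: "nat \<Rightarrow> nat \<Rightarrow> nat \<Rightarrow> real \<Rightarrow> nat \<Rightarrow> nat \<Rightarrow> real" where
  "moment \<sigma> a N \<theta> 0 m = survival \<sigma> a N m"
| "moment \<sigma> a N \<theta> (Suc k) m = (\<Sum>l=1..N. length_weight \<sigma> \<theta> l * moment \<sigma> a N \<theta> k (m + l))"

text \<open>The prescribed images \<open>T u\<close> depend on the list itself because a cycle
  prescribes its own words as images.\<close>

definition cycle_configs ::
  "nat \<Rightarrow> nat \<Rightarrow> nat \<Rightarrow> real \<Rightarrow> nat \<Rightarrow> nat \<Rightarrow> (nat list list \<Rightarrow> nat list list) \<Rightarrow>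
    (nat list list \<times> (nat list \<Rightarrow> nat) \<times> (nat list list \<times> nat) list) set" where
  "cycle_configs r \<sigma> n \<theta> k m T = {(u, f, cs). u \<in> free_lists n \<sigma> m \<and> f \<in> rules r n \<and>
     map (word_step r f) u = T u \<and> length cs = k \<and> set cs \<subseteq> long_cycles r \<sigma> n \<theta> f \<and>
     distinct (map orb (concat (map fst cs) @ u))}"

lemma finite_rules [simp]: "finite (rules r n)"
  by (simp add: rules_def finite_PiE finite_words)

lemma finite_cycle_configs [simp]: "finite (cycle_configs r \<sigma> n \<theta> k m T)"
proof -
  let ?B = "(\<Union>m\<in>{..n ^ \<sigma>}. free_lists n \<sigma> m) \<times> {..<\<sigma>}"
  have sub: "cycle_configs r \<sigma> n \<theta> k m T \<subseteq>
     free_lists n \<sigma> m \<times> rules r n \<times> {cs. set cs \<subseteq> ?B \<and> length cs = k}"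
    unfolding cycle_configs_def long_cycles_def using cycles_subset[of r \<sigma> n] by blast
  have "finite {cs. set cs \<subseteq> ?B \<and> length cs = k}" by (rule finite_lists_length_eq) auto
  then show ?thesis by (intro finite_subset[OF sub]) simp
qed

lemma cycle_step_in_words:
  assumes "b \<noteq> []" "set b \<subseteq> words n \<sigma>"
  shows "length (cycle_step b s) = length b" "set (cycle_step b s) \<subseteq> words n \<sigma>"
proof -
  have "hd b \<in> words n \<sigma>" using assms by (meson hd_in_set subsetD)
  then have "rotate s (hd b) \<in> words n \<sigma>" by (simp add: words_def)
  then show "set (cycle_step b s) \<subseteq> words n \<sigma>"
    using assms list.set_sel(2)[of b] by (auto simp: cycle_step_def)
qed (use assms in \<open>auto simp: cycle_step_def\<close>)

text \<open>
  The target function \<open>T\<close> prescribes the images of a free list; peeling off the last cycle of a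
  configuration moves its words into the free list and extends \<open>T\<close> accordingly.
\<close>

lemma sum_cycle_configs:
  assumes "\<sigma> > 0" "\<sigma> \<le> r" "n > 0"
    and "\<And>u. u \<in> free_lists n \<sigma> m \<Longrightarrow> length (T u) = m \<and> set (T u) \<subseteq> words n \<sigma>"
  shows "(\<Sum>(u, f, cs)\<in>cycle_configs r \<sigma> n \<theta> k m T. cycle_weight \<sigma> cs)
    = real (card (rules r n)) * moment \<sigma> (card (pwords n \<sigma>)) (n ^ \<sigma>) \<theta> k m"
  using assms(4)
proof (induction k arbitrary: m T)
  case 0
  let ?R = "\<lambda>u. {f \<in> rules r n. map (word_step r f) u = T u}"
  have eq: "cycle_configs r \<sigma> n \<theta> 0 m T = (\<lambda>(u, f). (u, f, [])) ` (SIGMA u : free_lists n \<sigma> m. ?R u)"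
    by (auto simp: cycle_configs_def free_lists_def)
  have "(\<Sum>(u, f, cs)\<in>cycle_configs r \<sigma> n \<theta> 0 m T. cycle_weight \<sigma> cs)
     = real (card (cycle_configs r \<sigma> n \<theta> 0 m T))"
    unfolding real_of_card by (intro sum.cong) (auto simp: cycle_configs_def cycle_weight_def)
  also have "card (cycle_configs r \<sigma> n \<theta> 0 m T) = card (SIGMA u : free_lists n \<sigma> m. ?R u)"
    unfolding eq by (rule card_image) (auto simp: inj_on_def)
  also have "\<dots> = (\<Sum>u\<in>free_lists n \<sigma> m. card (?R u))"
    by (rule card_SigmaI) auto
  \<comment> \<open>Each free list has its prescribed images with probability
    \<open>1 / N ^ m\<close> for \<open>N = n ^ \<sigma>\<close>, and the number of free lists
    divided by \<open>N ^ m\<close> is \<open>survival\<close>.\<close>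
  also have "real (\<Sum>u\<in>free_lists n \<sigma> m. card (?R u)) = (\<Sum>u\<in>free_lists n \<sigma> m. real (card (rules r n)) / real (n ^ \<sigma>) ^ m)"
    unfolding of_nat_sum using assms 0 by (intro sum.cong refl card_rules_prescribed) auto
  also have "\<dots> = real (card (rules r n)) * (real (card (free_lists n \<sigma> m)) / real (n ^ \<sigma>) ^ m)"
    by simp
  also have "real (card (free_lists n \<sigma> m)) / real (n ^ \<sigma>) ^ m = survival \<sigma> (card (pwords n \<sigma>)) (n ^ \<sigma>) m"
    by (simp add: survival_def card_free_lists[OF assms(1)] prod_dividef)
  finally show ?case by simp
next
  case (Suc k)
  let ?mom = "moment \<sigma> (card (pwords n \<sigma>)) (n ^ \<sigma>) \<theta>"
  define ST where "ST = (SIGMA l : {1..n ^ \<sigma>}. long_shifts \<sigma> \<theta> l)"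
  define T' where "T' = (\<lambda>(l, s) u. cycle_step (take l u) s @ T (drop l u))"
  define Z where "Z = (\<lambda>(l, s). cycle_configs r \<sigma> n \<theta> k (m + l) (T' (l, s)))"
  define w where "w = (\<lambda>(l, s :: nat). 1 / real (\<sigma> * l))"
  have finST: "finite ST" by (auto simp: ST_def)
  have drop_free: "drop l u \<in> free_lists n \<sigma> m" "take l u \<in> free_lists n \<sigma> l"
    if "u \<in> free_lists n \<sigma> (m + l)" for l u
    using that set_drop_subset[of l u] set_take_subset[of l u]
    by (auto simp: free_lists_def distinct_drop distinct_take simp flip: drop_map take_map)
  have T': "length (T' (l, s) u) = m + l \<and> set (T' (l, s) u) \<subseteq> words n \<sigma>"
    if "(l, s) \<in> ST" "u \<in> free_lists n \<sigma> (m + l)" for l s u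
  proof -
    have "take l u \<noteq> []" "set (take l u) \<subseteq> words n \<sigma>"
      using that drop_free(2)[OF that(2)] by (auto simp: ST_def free_lists_def pwords_def)
    then show ?thesis
      using cycle_step_in_words[of "take l u" n \<sigma> s] Suc.prems[OF drop_free(1)[OF that(2)]]
        drop_free(2)[OF that(2)]
      by (auto simp: T'_def free_lists_def)
  qed
  have "(\<Sum>(u, f, cs)\<in>cycle_configs r \<sigma> n \<theta> (Suc k) m T. cycle_weight \<sigma> cs)
     = (\<Sum>(p, u, f, cs)\<in>(SIGMA p : ST. Z p). w p * cycle_weight \<sigma> cs)"
  proof (rule sum.reindex_bij_witness[symmetric,
        where j = "\<lambda>((l, s), u, f, cs). (drop l u, f, cs @ [(take l u, s)])"
          and i = "\<lambda>(u, f, cs). ((length (fst (last cs)), snd (last cs)), fst (last cs) @ u, f, butlast cs)"],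
        goal_cases)
    case (1 x)
    obtain l s u f cs where x: "x = ((l, s), u, f, cs)" by (metis prod.exhaust)
    have "length u = m + l" using 1 unfolding x by (auto simp: Z_def cycle_configs_def free_lists_def)
    then show ?case unfolding x by simp
  next
    case (2 x)
    obtain l s u f cs where x: "x = ((l, s), u, f, cs)" by (metis prod.exhaust)
    have ls: "1 \<le> l" "l \<le> n ^ \<sigma>" "s < \<sigma>" "\<theta> < real (cycle_period \<sigma> l s)"
      using 2 unfolding x by (auto simp: ST_def long_shifts_def)
    have u: "u \<in> free_lists n \<sigma> (m + l)" and f: "f \<in> rules r n" "map (word_step r f) u = T' (l, s) u"
      and cs: "length cs = k" "set cs \<subseteq> long_cycles r \<sigma> n \<theta> f" "distinct (map orb (concat (map fst cs) @ u))"
      using 2 unfolding x by (auto simp: Z_def cycle_configs_def)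
    have tk: "length (take l u) = l" "take l u \<noteq> []" using u ls by (auto simp: free_lists_def)
    have "map (word_step r f) (take l u) @ map (word_step r f) (drop l u)
        = cycle_step (take l u) s @ T (drop l u)"
      using f(2) by (simp add: T'_def flip: map_append)
    moreover have "length (cycle_step (take l u) s) = length (take l u)"
      using tk by (cases "take l u") (auto simp: cycle_step_def)
    ultimately have step: "map (word_step r f) (take l u) = cycle_step (take l u) s"
      "map (word_step r f) (drop l u) = T (drop l u)"
      by auto
    have "(take l u, s) \<in> long_cycles r \<sigma> n \<theta> f"
      using tk drop_free(2)[OF u] ls step(1) by (simp add: long_cycles_def cycles_def)
    moreover have "distinct (map orb (concat (map fst (cs @ [(take l u, s)])) @ drop l u))"
      using cs(3) by simp
    moreover have "length (cs @ [(take l u, s)]) = Suc k" using cs(1) by simp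
    moreover have "set (cs @ [(take l u, s)]) \<subseteq> long_cycles r \<sigma> n \<theta> f"
      using cs(2) \<open>(take l u, s) \<in> long_cycles r \<sigma> n \<theta> f\<close> by simp
    ultimately show ?case
      using drop_free(1)[OF u] f(1) step(2) unfolding x cycle_configs_def prod.case mem_Collect_eq by blast
  next
    case (3 x)
    obtain u f cs where x: "x = (u, f, cs)" by (metis prod.exhaust)
    have "cs \<noteq> []" using 3 unfolding x by (auto simp: cycle_configs_def)
    then show ?case unfolding x by simp
  next
    case (4 x)
    obtain u f ds where x: "x = (u, f, ds)" by (metis prod.exhaust)
    have u: "u \<in> free_lists n \<sigma> m" and f: "f \<in> rules r n" "map (word_step r f) u = T u"
      and ds: "length ds = Suc k" "set ds \<subseteq> long_cycles r \<sigma> n \<theta> f"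
        "distinct (map orb (concat (map fst ds) @ u))"
      using 4 unfolding x by (auto simp: cycle_configs_def)
    obtain cs b s where ds_eq: "ds = cs @ [(b, s)]" using ds(1) by (metis length_Suc_conv_rev prod.exhaust)
    have b: "b \<noteq> []" "b \<in> free_lists n \<sigma> (length b)" "s < \<sigma>" "map (word_step r f) b = cycle_step b s"
        "\<theta> < real (cycle_period \<sigma> (length b) s)"
      using ds(2) unfolding ds_eq by (auto simp: long_cycles_def cycles_def)
    have bu: "b @ u \<in> free_lists n \<sigma> (m + length b)"
      using u b(2) ds(3) unfolding ds_eq by (auto simp: free_lists_def)
    \<comment> \<open>A free list has at most \<open>n ^ \<sigma>\<close> entries, so the upper
      limit of the sum in \<open>moment\<close> loses no cycle.\<close>
    have "(length b, s) \<in> ST"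
      using b free_lists_length_le[OF b(2)] by (cases b) (auto simp: ST_def long_shifts_def)
    moreover have "(b @ u, f, cs) \<in> Z (length b, s)"
      using bu f b(4) ds unfolding ds_eq by (simp add: Z_def cycle_configs_def T'_def image_Un)
    ultimately show ?case unfolding x ds_eq by simp
  next
    case (5 x)
    obtain l s u f cs where x: "x = ((l, s), u, f, cs)" by (metis prod.exhaust)
    have "length u = m + l" using 5 unfolding x by (auto simp: Z_def cycle_configs_def free_lists_def)
    then show ?case unfolding x by (simp add: cycle_weight_def w_def)
  qed
  also have "\<dots> = (\<Sum>p\<in>ST. \<Sum>(u, f, cs)\<in>Z p. w p * cycle_weight \<sigma> cs)"
    using finST by (subst sum.Sigma) (auto simp: Z_def split_def)
  also have "\<dots> = (\<Sum>p\<in>ST. w p * (real (card (rules r n)) * ?mom k (m + fst p)))"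
  proof (rule sum.cong[OF refl])
    fix p assume p: "p \<in> ST"
    obtain l s where ls: "p = (l, s)" by (cases p)
    have "(\<Sum>(u, f, cs)\<in>Z p. cycle_weight \<sigma> cs) = real (card (rules r n)) * ?mom k (m + l)"
      unfolding Z_def ls prod.case using T' p ls by (intro Suc.IH) auto
    then show "(\<Sum>(u, f, cs)\<in>Z p. w p * cycle_weight \<sigma> cs)
        = w p * (real (card (rules r n)) * ?mom k (m + fst p))"
      using ls by (simp add: split_def flip: sum_distrib_left)
  qed
  also have "\<dots> = (\<Sum>l=1..n ^ \<sigma>. \<Sum>s\<in>long_shifts \<sigma> \<theta> l. w (l, s) * (real (card (rules r n)) * ?mom k (m + l)))"
    unfolding ST_def by (subst sum.Sigma) (auto simp: split_def)
  also have "\<dots> = real (card (rules r n)) * ?mom (Suc k) m"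
    by (simp add: w_def length_weight_def sum_distrib_left algebra_simps)
  finally show ?case .
qed

lemma sum_num_long_cycles:
  assumes "\<sigma> > 0" "\<sigma> \<le> r" "n > 0"
  shows "(\<Sum>f\<in>rules r n. fact k * real (num_long_cycles r \<sigma> n \<theta> f choose k))
    = real (card (rules r n)) * moment \<sigma> (card (pwords n \<sigma>)) (n ^ \<sigma>) \<theta> k 0"
proof -
  let ?L = "\<lambda>f. {cs. length cs = k \<and> set cs \<subseteq> long_cycles r \<sigma> n \<theta> f \<and> distinct (map orb (concat (map fst cs)))}"
  have fin: "finite (?L f)" for f
    by (rule finite_subset[OF _ finite_lists_length_eq[of "long_cycles r \<sigma> n \<theta> f" k]]) auto
  have "(\<Sum>f\<in>rules r n. fact k * real (num_long_cycles r \<sigma> n \<theta> f choose k))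
     = (\<Sum>f\<in>rules r n. \<Sum>cs\<in>?L f. cycle_weight \<sigma> cs)"
    using sum_cycle_weight[OF assms(1)] by (intro sum.cong) auto
  also have "\<dots> = (\<Sum>(f, cs)\<in>(SIGMA f : rules r n. ?L f). cycle_weight \<sigma> cs)"
    using fin by (intro sum.Sigma) auto
  also have "\<dots> = (\<Sum>(u, f, cs)\<in>cycle_configs r \<sigma> n \<theta> k 0 (\<lambda>_. []). cycle_weight \<sigma> cs)"
    by (rule sum.reindex_bij_witness[where j = "\<lambda>(f, cs). ([], f, cs)" and i = "\<lambda>(u, f, cs). (f, cs)"])
      (auto simp: cycle_configs_def free_lists_def)
  also have "\<dots> = real (card (rules r n)) * moment \<sigma> (card (pwords n \<sigma>)) (n ^ \<sigma>) \<theta> k 0"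
    by (rule sum_cycle_configs[OF assms]) (simp add: free_lists_def)
  finally show ?thesis .
qed

section \<open>From factorial moments to tail probabilities\<close>

lemma alternating_sum_choose:
  assumes "W \<le> M"
  shows "(\<Sum>k\<le>M. (-1) ^ k * real (W choose k)) = (if W = 0 then 1 else 0)"
proof -
  have "(\<Sum>k\<le>M. (-1) ^ k * real (W choose k)) = (\<Sum>k\<le>W. (-1) ^ k * real (W choose k))"
    using assms by (intro sum.mono_neutral_right) (auto simp: binomial_eq_0)
  then show ?thesis using choose_alternating_sum[of W, where 'a = real] by auto
qed

definition tail_prob :: "nat \<Rightarrow> nat \<Rightarrow> nat \<Rightarrow> real \<Rightarrow> real" where
  "tail_prob r \<sigma> n \<theta> = real (card {f \<in> rules r n. \<theta> < real (longest_period r \<sigma> n f)}) / real (card (rules r n))"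

context
  fixes r \<sigma> n :: nat and \<theta> :: real
  assumes pos: "\<sigma> > 0" and le: "\<sigma> \<le> r" and n: "n > 0" and \<theta>: "\<theta> \<ge> 0"
begin

private abbreviation (input) "mom \<equiv> moment \<sigma> (card (pwords n \<sigma>)) (n ^ \<sigma>) \<theta>"
private abbreviation (input) "nlc \<equiv> num_long_cycles r \<sigma> n \<theta>"

lemma card_rules_pos: "real (card (rules r n)) > 0"
  using n by (simp add: card_rules)

lemma moment_eq_mean: "mom k 0 / fact k = (\<Sum>f\<in>rules r n. real (nlc f choose k)) / real (card (rules r n))"
  using sum_num_long_cycles[OF pos le n, where k = k and \<theta> = \<theta>] card_rules_pos
  by (subst frac_eq_eq) (auto simp: mult.commute simp flip: sum_distrib_left)

lemma num_long_cycles_le: "nlc f \<le> n ^ \<sigma>"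
proof -
  have "nlc f \<le> card (long_words r \<sigma> n \<theta> f)"
    unfolding num_long_cycles_def by (rule card_image_le) simp
  also have "\<dots> \<le> card (pwords n \<sigma>)" by (rule card_mono) (auto simp: long_words_def)
  finally show ?thesis using card_pwords_le by (rule le_trans)
qed

lemma tail_prob_eq:
  "tail_prob r \<sigma> n \<theta> = (\<Sum>f\<in>rules r n. of_bool (nlc f > 0)) / real (card (rules r n))"
proof -
  have "{f \<in> rules r n. \<theta> < real (longest_period r \<sigma> n f)} = {f \<in> rules r n. nlc f > 0}"
    using longest_period_gt_iff[OF pos _ \<theta>] by blast
  moreover have "real (card {f \<in> rules r n. nlc f > 0}) = (\<Sum>f\<in>rules r n. of_bool (nlc f > 0))"
    by (simp add: of_bool_def Int_def flip: sum.inter_filter)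
  ultimately show ?thesis by (simp add: tail_prob_def)
qed

text \<open>At most \<open>n ^ \<sigma>\<close> terms are nonzero, but that number grows with
  \<open>n\<close>; the form of an infinite series lets the limit be taken term by term.\<close>

lemma tail_prob_sums:
  "(\<lambda>k. (-1) ^ k * (mom k 0 / fact k)) sums (1 - tail_prob r \<sigma> n \<theta>)"
proof -
  have z: "mom k 0 / fact k = 0" if "k \<notin> {..n ^ \<sigma>}" for k
  proof -
    have "nlc f choose k = 0" for f
      using that num_long_cycles_le[of f] by (simp add: binomial_eq_0)
    then show ?thesis unfolding moment_eq_mean by (simp only: sum.neutral_const of_nat_0 div_0)
  qed
  have "(\<lambda>k. (-1) ^ k * (mom k 0 / fact k)) sums (\<Sum>k\<le>n ^ \<sigma>. (-1) ^ k * (mom k 0 / fact k))"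
    by (rule sums_finite) (use z in auto)
  also have "(\<Sum>k\<le>n ^ \<sigma>. (-1) ^ k * (mom k 0 / fact k))
      = (\<Sum>k\<le>n ^ \<sigma>. \<Sum>f\<in>rules r n. (-1) ^ k * real (nlc f choose k)) / real (card (rules r n))"
    unfolding moment_eq_mean by (simp add: sum_divide_distrib sum_distrib_left)
  also have "(\<Sum>k\<le>n ^ \<sigma>. \<Sum>f\<in>rules r n. (-1) ^ k * real (nlc f choose k))
      = (\<Sum>f\<in>rules r n. \<Sum>k\<le>n ^ \<sigma>. (-1) ^ k * real (nlc f choose k))"
    by (rule sum.swap)
  also have "\<dots> = (\<Sum>f\<in>rules r n. 1 - of_bool (nlc f > 0))"
    using alternating_sum_choose[OF num_long_cycles_le] by (intro sum.cong) auto
  also have "\<dots> / real (card (rules r n)) = 1 - tail_prob r \<sigma> n \<theta>"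
    unfolding tail_prob_eq using card_rules_pos by (auto simp: sum_subtractf diff_divide_distrib)
  finally show ?thesis .
qed

lemma tail_prob_le: "tail_prob r \<sigma> n \<theta> \<le> mom 1 0"
proof -
  have "(\<Sum>f\<in>rules r n. of_bool (nlc f > 0)) \<le> (\<Sum>f\<in>rules r n. real (nlc f choose 1))"
    by (intro sum_mono) auto
  then have "tail_prob r \<sigma> n \<theta> \<le> mom 1 0 / fact 1"
    unfolding tail_prob_eq moment_eq_mean by (rule divide_right_mono) simp
  then show ?thesis by simp
qed

text \<open>Inclusion-exclusion cut off after the second term, from
  \<open>w - (w choose 2) \<le> 1\<close> for \<open>w \<ge> 1\<close>.\<close>

lemma tail_prob_ge: "mom 1 0 - mom 2 0 / 2 \<le> tail_prob r \<sigma> n \<theta>"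
proof -
  have b: "real (w choose 1) - real (w choose 2) \<le> of_bool (w > 0)" for w :: nat
  proof (cases "w \<le> 1")
    case False
    then have "w \<le> 1 + (w choose 2)"
    proof (induction w)
      case (Suc w)
      then show ?case by (cases "w \<le> 1") (auto simp: numeral_2_eq_2 le_Suc_eq)
    qed simp
    then have "real w \<le> 1 + real (w choose 2)" by linarith
    then show ?thesis using False by simp
  qed (auto simp: le_Suc_eq)
  have "mom 1 0 / fact 1 - mom 2 0 / fact 2
      = (\<Sum>f\<in>rules r n. real (nlc f choose 1) - real (nlc f choose 2)) / real (card (rules r n))"
    unfolding moment_eq_mean by (simp add: sum_subtractf diff_divide_distrib)
  also have "\<dots> \<le> tail_prob r \<sigma> n \<theta>"
    unfolding tail_prob_eq by (intro divide_right_mono sum_mono b) simp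
  finally show ?thesis by simp
qed

end

section \<open>Bounds on the moments, uniform in the number of states\<close>

lemma survival_nonneg: "0 \<le> survival \<sigma> a N m"
  by (auto simp: survival_def intro!: prod_nonneg)

text \<open>Words already placed leave less room: the factor with index \<open>m + j\<close> is at
  most the one with index \<open>j\<close>. This is the competition between cycles in quantitative
  form.\<close>

lemma survival_add_le:
  assumes "a \<le> N"
  shows "survival \<sigma> a N (m + l) \<le> survival \<sigma> a N m * survival \<sigma> a N l"
proof -
  have "survival \<sigma> a N (m + l) = survival \<sigma> a N m * (\<Prod>j<l. real (a - (m + j) * \<sigma>) / real N)"
    unfolding survival_def
  proof (induction l)
    case (Suc l)
    then show ?case by (simp add: mult.assoc)
  qed simp
  also have "\<dots> \<le> survival \<sigma> a N m * survival \<sigma> a N l"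
    unfolding survival_def
    by (intro mult_left_mono prod_mono prod_nonneg conjI)
      (auto intro!: divide_right_mono diff_le_mono2 mult_right_mono)
  finally show ?thesis .
qed

text \<open>The true decay is Gaussian in \<open>m / sqrt N\<close>. It is weakened to a simple
  exponential, which can be summed as a geometric series and serves as an integrable
  majorant.\<close>

lemma survival_le_exp:
  assumes "a \<le> N" "\<sigma> > 0" "N > 0"
  shows "survival \<sigma> a N m \<le> exp (2 - real m / sqrt (real N))"
proof -
  have f: "real (a - j * \<sigma>) / real N \<le> exp (- real j / real N)" for j
  proof (cases "j * \<sigma> \<le> a")
    case True
    have "j * 1 \<le> j * \<sigma>" using assms(2) by (intro mult_left_mono) auto
    then have "real (a - j * \<sigma>) \<le> real N - real j" using True assms(1) by linarith
    then have "real (a - j * \<sigma>) / real N \<le> 1 + (- real j / real N)"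
      using assms(3) by (simp add: field_simps)
    also have "\<dots> \<le> exp (- real j / real N)" by (rule exp_ge_add_one_self)
    finally show ?thesis .
  qed simp
  define t where "t = real m / sqrt (real N)"
  have N1: "sqrt (real N) \<ge> 1" using assms(3) by simp
  have t0: "t \<ge> 0" by (simp add: t_def)
  have t2: "t * t = real m * real m / real N" using assms(3) by (simp add: t_def)
  have "survival \<sigma> a N m \<le> (\<Prod>j<m. exp (- real j / real N))"
    unfolding survival_def using f by (intro prod_mono) auto
  also have "\<dots> = exp (\<Sum>j<m. - real j / real N)" by (simp add: exp_sum)
  also have "(\<Sum>j<m. - real j / real N) = - (real m * (real m - 1) / 2) / real N"
  proof -
    have "(\<Sum>j<m. real j) = real m * (real m - 1) / 2"
      by (induction m) (auto simp: field_simps)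
    moreover have "(\<Sum>j<m. - real j / real N) = - (\<Sum>j<m. real j) / real N"
      by (simp add: sum_negf sum_divide_distrib)
    ultimately show ?thesis by (simp only:)
  qed
  also have "\<dots> = - (t * t) / 2 + (real m / real N) / 2"
    using assms(3) by (simp add: t2 field_simps)
  also have "\<dots> \<le> 2 - t"
  proof -
    have "real m / real N = t / sqrt (real N)" by (simp add: t_def)
    also have "\<dots> \<le> t" using N1 t0 by (simp add: divide_le_eq mult_le_cancel_left1)
    finally have "- (t * t) / 2 + (real m / real N) / 2 \<le> - (t * t) / 2 + t / 2" by simp
    \<comment> \<open>The left side plus \<open>t\<close> has maximum \<open>9/8\<close>, at
      \<open>t = 3/2\<close>; the constant \<open>2\<close> is a round number above it.\<close>
    also have "\<dots> \<le> 2 - t" using zero_le_power2[of "t - 3/2"] by (simp add: power2_eq_square field_simps)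
    finally show ?thesis .
  qed
  finally show ?thesis by (simp add: t_def)
qed

lemma length_weight_nonneg: "0 \<le> length_weight \<sigma> \<theta> l"
  by (simp add: length_weight_def)

text \<open>The weight vanishes unless some shift gives a long period, which forces
  \<open>l * \<sigma> > \<theta>\<close>; in any case it is at most \<open>1 / l\<close>. The factor
  \<open>1 / x\<close> in the mean comes from here.\<close>

lemma length_weight_le:
  assumes "\<sigma> > 0" "\<theta> > 0"
  shows "length_weight \<sigma> \<theta> l \<le> real \<sigma> / \<theta>"
proof (cases "long_shifts \<sigma> \<theta> l = {}")
  case False
  then obtain s where s: "\<theta> < real (cycle_period \<sigma> l s)" by (auto simp: long_shifts_def)
  have "cycle_period \<sigma> l s \<le> l * \<sigma>" by (simp add: cycle_period_def)
  then have "real (cycle_period \<sigma> l s) \<le> real (l * \<sigma>)" by (rule of_nat_mono)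
  then have ls: "\<theta> < real l * real \<sigma>" using s by simp
  then have l: "0 < l" using assms by (cases l) auto
  have "card (long_shifts \<sigma> \<theta> l) \<le> card {..<\<sigma>}" by (rule card_mono) (auto simp: long_shifts_def)
  then have "length_weight \<sigma> \<theta> l \<le> real \<sigma> / real (\<sigma> * l)"
    unfolding length_weight_def by (intro divide_right_mono) auto
  also have "\<dots> = 1 / real l" using assms by simp
  also have "\<dots> \<le> real \<sigma> / \<theta>" using ls l assms by (simp add: field_simps)
  finally show ?thesis .
qed (use assms in \<open>simp add: length_weight_def\<close>)

lemma moment_nonneg: "0 \<le> moment \<sigma> a N \<theta> k m"
  by (induction k arbitrary: m) (auto simp: survival_nonneg length_weight_nonneg intro!: sum_nonneg)

text \<open>By \<open>survival_add_le\<close> the lengths split off one at a time, as if the cycles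
  were independent.\<close>

lemma moment_le:
  assumes "a \<le> N"
  shows "moment \<sigma> a N \<theta> k m \<le> survival \<sigma> a N m * moment \<sigma> a N \<theta> 1 0 ^ k"
proof (induction k arbitrary: m)
  case (Suc k)
  let ?B = "moment \<sigma> a N \<theta> 1 0"
  have B: "?B = (\<Sum>l=1..N. length_weight \<sigma> \<theta> l * survival \<sigma> a N l)" by simp
  have "moment \<sigma> a N \<theta> (Suc k) m
      \<le> (\<Sum>l=1..N. length_weight \<sigma> \<theta> l * ((survival \<sigma> a N m * survival \<sigma> a N l) * ?B ^ k))"
    unfolding moment.simps(2)
  proof (intro sum_mono mult_left_mono length_weight_nonneg)
    fix l
    have "moment \<sigma> a N \<theta> k (m + l) \<le> survival \<sigma> a N (m + l) * ?B ^ k" by (rule Suc.IH)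
    also have "\<dots> \<le> (survival \<sigma> a N m * survival \<sigma> a N l) * ?B ^ k"
      by (intro mult_right_mono survival_add_le[OF assms] zero_le_power moment_nonneg)
    finally show "moment \<sigma> a N \<theta> k (m + l) \<le> (survival \<sigma> a N m * survival \<sigma> a N l) * ?B ^ k" .
  qed
  also have "\<dots> = survival \<sigma> a N m * (?B * ?B ^ k)"
    unfolding B by (simp add: sum_distrib_left sum_distrib_right algebra_simps)
  finally show ?case by simp
qed simp

text \<open>The weights are at most \<open>\<sigma> / (x * sqrt N)\<close> and the survival
  probabilities sum to at most \<open>exp 2 * sqrt N\<close>, so the scale cancels.\<close>

lemma moment_1_le:
  assumes "a \<le> N" "\<sigma> > 0" "N > 0" "x > 0"
  shows "moment \<sigma> a N (x * sqrt (real N)) 1 0 \<le> exp 2 * real \<sigma> / x"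
proof -
  let ?c = "sqrt (real N)"
  have c: "?c > 0" using assms by simp
  define q where "q = exp (- 1 / ?c)"
  have q: "0 < q" "q < 1" using c by (simp_all add: q_def)
  \<comment> \<open>The full geometric series is \<open>1 / (exp (1 / c) - 1)\<close> with
    \<open>c = sqrt N\<close>, which is at most \<open>c\<close>.\<close>
  have geo: "(\<Sum>l=1..N. q ^ l) \<le> ?c"
  proof -
    have "1 + 1 / ?c \<le> exp (1 / ?c)" by (rule exp_ge_add_one_self)
    then have "q * (1 + 1 / ?c) \<le> q * exp (1 / ?c)" using q by (intro mult_left_mono) auto
    also have "q * exp (1 / ?c) = 1" by (simp add: q_def flip: exp_add)
    finally have *: "q \<le> ?c * (1 - q)" using c by (simp add: field_simps)
    have "(\<Sum>l=1..N. q ^ l) * (1 - q) = q - q ^ Suc N"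
    proof (induction N)
      case (Suc N)
      have "(\<Sum>l=1..Suc N. q ^ l) * (1 - q) = (\<Sum>l=1..N. q ^ l) * (1 - q) + q ^ Suc N * (1 - q)"
        by (simp add: distrib_right)
      moreover have "q ^ Suc N * (1 - q) = q ^ Suc N - q ^ Suc (Suc N)" by (simp add: algebra_simps)
      ultimately show ?case using Suc by linarith
    qed simp
    also have "\<dots> \<le> ?c * (1 - q)" using * q zero_le_power[of q "Suc N"] by linarith
    finally show ?thesis using q by (simp add: mult_le_cancel_right)
  qed
  have "moment \<sigma> a N (x * ?c) 1 0 = (\<Sum>l=1..N. length_weight \<sigma> (x * ?c) l * survival \<sigma> a N l)" by simp
  also have "\<dots> \<le> (\<Sum>l=1..N. real \<sigma> / (x * ?c) * (exp 2 * q ^ l))"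
  proof (intro sum_mono mult_mono length_weight_le survival_nonneg)
    fix l
    have "exp 2 * q ^ l = exp (2 - real l / ?c)"
      by (simp add: q_def exp_diff exp_minus inverse_eq_divide power_divide flip: exp_of_nat_mult)
    then show "survival \<sigma> a N l \<le> exp 2 * q ^ l"
      using survival_le_exp[OF assms(1-3), of l] by simp
  qed (use assms c in auto)
  also have "\<dots> = real \<sigma> / (x * ?c) * exp 2 * (\<Sum>l=1..N. q ^ l)"
    by (simp add: sum_distrib_left mult.assoc)
  also have "\<dots> \<le> real \<sigma> / (x * ?c) * exp 2 * ?c"
    using geo assms by (intro mult_left_mono) auto
  also have "\<dots> = exp 2 * real \<sigma> / x" using c by simp
  finally show ?thesis .
qed

lemma moment_le_exp:
  assumes "a \<le> N" "\<sigma> > 0" "N > 0" "x > 0"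
  shows "moment \<sigma> a N (x * sqrt (real N)) k m \<le> exp (2 - real m / sqrt (real N)) * (exp 2 * real \<sigma> / x) ^ k"
proof -
  have "moment \<sigma> a N (x * sqrt (real N)) k m
      \<le> survival \<sigma> a N m * moment \<sigma> a N (x * sqrt (real N)) 1 0 ^ k"
    by (rule moment_le[OF assms(1)])
  also have "\<dots> \<le> exp (2 - real m / sqrt (real N)) * (exp 2 * real \<sigma> / x) ^ k"
    by (intro mult_mono survival_le_exp power_mono moment_1_le moment_nonneg zero_le_power assms) simp
  finally show ?thesis .
qed

text \<open>Only lengths from \<open>M\<close> to \<open>2 * M - 1\<close> are kept. They exceed the
  threshold for every shift, so their weight is exactly \<open>1 / l\<close>, and each of the
  \<open>M\<close> terms is at least \<open>survival\<close> at \<open>2 * M\<close> divided by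
  \<open>2 * M\<close>.\<close>

lemma moment_1_ge:
  assumes "\<sigma> > 0" "x > 0" "a \<le> N" and M: "M = nat \<lfloor>x * c\<rfloor> + 1" "2 * M \<le> N" and c: "c > 0"
  shows "survival \<sigma> a N (2 * M) / 2 \<le> moment \<sigma> a N (x * c) 1 0"
proof -
  have xc: "x * c < real M" using M(1) assms by linarith
  have anti: "survival \<sigma> a N (2 * M) \<le> survival \<sigma> a N l" if "l \<le> 2 * M" for l
  proof -
    have "survival \<sigma> a N l \<ge> survival \<sigma> a N l * survival \<sigma> a N (2 * M - l)"
      using assms(3) unfolding survival_def
      by (intro mult_right_le_one_le prod_le_1 prod_nonneg) (auto simp: divide_le_eq_1)
    moreover have "survival \<sigma> a N (l + (2 * M - l)) \<le> survival \<sigma> a N l * survival \<sigma> a N (2 * M - l)"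
      by (rule survival_add_le[OF assms(3)])
    ultimately show ?thesis using that by simp
  qed
  have w: "length_weight \<sigma> (x * c) l = 1 / real l" if "M \<le> l" for l
  proof -
    have "s \<in> long_shifts \<sigma> (x * c) l" if "s < \<sigma>" for s
    proof -
      have "gcd s \<sigma> \<le> \<sigma>" using assms(1) by (simp add: dvd_imp_le)
      then have "1 \<le> \<sigma> div gcd s \<sigma>" using assms(1) by (simp add: Suc_leI div_greater_zero_iff)
      then have "l * 1 \<le> cycle_period \<sigma> l s" unfolding cycle_period_def by (rule mult_left_mono) simp
      then have "real M \<le> real (cycle_period \<sigma> l s)" using \<open>M \<le> l\<close> by simp
      then show ?thesis using xc \<open>s < \<sigma>\<close> by (simp add: long_shifts_def)
    qed
    then have "long_shifts \<sigma> (x * c) l = {..<\<sigma>}" by (auto simp: long_shifts_def)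
    then show ?thesis using assms(1) by (simp add: length_weight_def)
  qed
  have M0: "real M > 0" using M(1) by simp
  have "survival \<sigma> a N (2 * M) / 2 = (\<Sum>l=M..<2 * M. survival \<sigma> a N (2 * M) / (2 * real M))"
    using M0 by simp
  also have "\<dots> \<le> (\<Sum>l=M..<2 * M. length_weight \<sigma> (x * c) l * survival \<sigma> a N l)"
  proof (intro sum_mono)
    fix l assume l: "l \<in> {M..<2 * M}"
    have "1 / (2 * real M) \<le> 1 / real l" using l M0 by (intro divide_left_mono) auto
    then have "1 / (2 * real M) * survival \<sigma> a N (2 * M) \<le> 1 / real l * survival \<sigma> a N l"
      using l by (intro mult_mono anti survival_nonneg) auto
    then show "survival \<sigma> a N (2 * M) / (2 * real M) \<le> length_weight \<sigma> (x * c) l * survival \<sigma> a N l"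
      using w l by simp
  qed
  also have "\<dots> \<le> (\<Sum>l=1..N. length_weight \<sigma> (x * c) l * survival \<sigma> a N l)"
    using M by (intro sum_mono2) (auto simp: length_weight_nonneg survival_nonneg)
  also have "\<dots> = moment \<sigma> a N (x * c) 1 0" by simp
  finally show ?thesis .
qed

subsection \<open>Limits of the factorial moments\<close>

text \<open>An exact identity with a step function of step width \<open>1 / c\<close>, so that
  dominated convergence for integrals applies to the sums.\<close>

lemma sum_eq_integral_steps:
  fixes G :: "nat \<Rightarrow> real"
  assumes "c > 0"
  shows "(\<Sum>l=1..N. G l) = (LINT y|lborel. (\<Sum>l=1..N. c * G l * indicator {(real l - 1) / c..<real l / c} y))"
proof -
  have le: "(real l - 1) / c \<le> real l / c" for l
    using assms by (intro divide_right_mono) auto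
  have m: "measure lborel {(real l - 1) / c..<real l / c} = 1 / c" for l
    using le assms by (simp add: field_simps)
  have i: "integrable lborel (\<lambda>y. c * G l * indicator {(real l - 1) / c..<real l / c} y)" for l
    by (intro integrable_mult_right integrable_real_indicator) (auto simp: le)
  have "(LINT y|lborel. (\<Sum>l=1..N. c * G l * indicator {(real l - 1) / c..<real l / c} y))
      = (\<Sum>l=1..N. LINT y|lborel. c * G l * indicator {(real l - 1) / c..<real l / c} y)"
    by (rule Bochner_Integration.integral_sum[OF i])
  also have "\<dots> = (\<Sum>l=1..N. G l)"
  proof (rule sum.cong[OF refl])
    fix l
    have "(LINT y|lborel. c * G l * indicator {(real l - 1) / c..<real l / c} y)
        = c * G l * (LINT y|lborel. indicator {(real l - 1) / c..<real l / c} y)"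
      by (rule integral_mult_right_zero)
    also have "(LINT y|lborel. indicator {(real l - 1) / c..<real l / c} y) = 1 / c"
      using m[of l] by simp
    finally show "(LINT y|lborel. c * G l * indicator {(real l - 1) / c..<real l / c} y) = G l"
      using assms by simp
  qed
  finally show ?thesis by simp
qed

text \<open>The steps are closed on the left and the first one starts at \<open>0\<close>, hence the
  index \<open>nat \<lfloor>y * c\<rfloor> + 1\<close> of the step over \<open>y\<close>.\<close>

lemma sum_steps_eq:
  fixes G :: "nat \<Rightarrow> real"
  assumes "c > 0"
  shows "(\<Sum>l=1..N. c * G l * indicator {(real l - 1) / c..<real l / c} y)
    = (if 0 \<le> y \<and> nat \<lfloor>y * c\<rfloor> + 1 \<le> N then c * G (nat \<lfloor>y * c\<rfloor> + 1) else 0)"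
proof -
  have iff: "y \<in> {(real l - 1) / c..<real l / c} \<longleftrightarrow> 0 \<le> y \<and> l = nat \<lfloor>y * c\<rfloor> + 1" if "1 \<le> l" for l
  proof -
    have "y \<in> {(real l - 1) / c..<real l / c} \<longleftrightarrow> real l - 1 \<le> y * c \<and> y * c < real l"
      using assms by (simp add: divide_le_eq less_divide_eq)
    also have "\<dots> \<longleftrightarrow> 0 \<le> y * c \<and> l = nat \<lfloor>y * c\<rfloor> + 1"
    proof
      assume A: "real l - 1 \<le> y * c \<and> y * c < real l"
      have "\<lfloor>y * c\<rfloor> = int l - 1" using A that by (intro floor_unique) auto
      moreover have "0 \<le> y * c" using A that by simp
      ultimately show "0 \<le> y * c \<and> l = nat \<lfloor>y * c\<rfloor> + 1" using that by simp
    qed linarith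
    finally show ?thesis using assms by (simp add: zero_le_mult_iff)
  qed
  have "(\<Sum>l=1..N. c * G l * indicator {(real l - 1) / c..<real l / c} y)
     = (\<Sum>l=1..N. if l = nat \<lfloor>y * c\<rfloor> + 1 then (if 0 \<le> y then c * G l else 0) else 0)"
    by (intro sum.cong refl) (use iff in \<open>auto simp: indicator_def\<close>)
  then show ?thesis by simp
qed

text \<open>For \<open>0 \<le> e \<le> \<epsilon> < 1/2\<close>, the logarithm of
  \<open>1 - e\<close> lies between \<open>- e - 2 * e^2\<close>, hence
  \<open>- (1 + 2 * \<epsilon>) * e\<close>, and \<open>- e\<close>.\<close>

lemma prod_one_minus_tendsto:
  fixes e :: "nat \<Rightarrow> nat \<Rightarrow> real"
  assumes nn: "\<And>n j. j < m n \<Longrightarrow> 0 \<le> e n j"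
    and le: "\<forall>\<^sub>F n in sequentially. \<forall>j<m n. e n j \<le> \<epsilon> n"
    and \<epsilon>: "\<epsilon> \<longlonglongrightarrow> 0"
    and S: "(\<lambda>n. \<Sum>j<m n. e n j) \<longlonglongrightarrow> S"
  shows "(\<lambda>n. \<Prod>j<m n. 1 - e n j) \<longlonglongrightarrow> exp (- S)"
proof (rule tendsto_sandwich)
  have half: "\<forall>\<^sub>F n in sequentially. \<epsilon> n < 1 / 2"
    using \<epsilon> by (rule order_tendstoD) simp
  show "\<forall>\<^sub>F n in sequentially. exp (- (1 + 2 * \<epsilon> n) * (\<Sum>j<m n. e n j)) \<le> (\<Prod>j<m n. 1 - e n j)"
    using le half
  proof eventually_elim
    case (elim n)
    have "exp (- (1 + 2 * \<epsilon> n) * (\<Sum>j<m n. e n j)) = (\<Prod>j<m n. exp (- (1 + 2 * \<epsilon> n) * e n j))"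
      by (simp add: sum_distrib_left exp_sum)
    also have "\<dots> \<le> (\<Prod>j<m n. 1 - e n j)"
    proof (intro prod_mono conjI)
      fix j assume "j \<in> {..<m n}"
      then have j: "0 \<le> e n j" "e n j \<le> \<epsilon> n" using nn elim by auto
      have "e n j * e n j \<le> \<epsilon> n * e n j" using j by (intro mult_right_mono)
      then have "- (1 + 2 * \<epsilon> n) * e n j \<le> - e n j - 2 * (e n j)\<^sup>2"
        by (simp add: power2_eq_square algebra_simps)
      also have "\<dots> \<le> ln (1 - e n j)" using j elim by (intro ln_one_minus_pos_lower_bound) auto
      finally have "exp (- (1 + 2 * \<epsilon> n) * e n j) \<le> exp (ln (1 - e n j))" by simp
      then show "exp (- (1 + 2 * \<epsilon> n) * e n j) \<le> 1 - e n j" using j elim by simp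
    qed simp
    finally show ?case .
  qed
  show "\<forall>\<^sub>F n in sequentially. (\<Prod>j<m n. 1 - e n j) \<le> exp (- (\<Sum>j<m n. e n j))"
    using le half
  proof eventually_elim
    case (elim n)
    have "(\<Prod>j<m n. 1 - e n j) \<le> (\<Prod>j<m n. exp (- e n j))"
    proof (intro prod_mono conjI)
      fix j assume "j \<in> {..<m n}"
      then have "e n j \<le> \<epsilon> n" using elim by auto
      then show "0 \<le> 1 - e n j" using elim by simp
      show "1 - e n j \<le> exp (- e n j)" using exp_ge_add_one_self[of "- e n j"] by simp
    qed
    then show ?case by (simp add: exp_sum sum_negf[symmetric])
  qed
  have "(\<lambda>n. exp (- (1 + 2 * \<epsilon> n) * (\<Sum>j<m n. e n j))) \<longlonglongrightarrow> exp (- (1 + 2 * 0) * S)"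
    by (intro tendsto_intros \<epsilon> S)
  then show "(\<lambda>n. exp (- (1 + 2 * \<epsilon> n) * (\<Sum>j<m n. e n j))) \<longlonglongrightarrow> exp (- S)" by simp
  show "(\<lambda>n. exp (- (\<Sum>j<m n. e n j))) \<longlonglongrightarrow> exp (- S)"
    by (intro tendsto_intros S)
qed

section \<open>The scaling limit\<close>

text \<open>Here \<kappa> is the limiting number of non-primitive words in units of
  \<open>sqrt N\<close>.\<close>

locale scaling =
  fixes \<sigma> :: nat and a N :: "nat \<Rightarrow> nat" and \<kappa> :: real
  assumes \<sigma>: "\<sigma> > 0" and a_le: "\<And>n. a n \<le> N n" and N_pos: "\<And>n. N n > 0"
    and N_lim: "filterlim (\<lambda>n. sqrt (real (N n))) at_top sequentially"
    and defect: "(\<lambda>n. (real (N n) - real (a n)) / sqrt (real (N n))) \<longlonglongrightarrow> \<kappa>"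
begin

abbreviation c :: "nat \<Rightarrow> real" where "c n \<equiv> sqrt (real (N n))"

lemma c_pos: "c n > 0" using N_pos by simp

lemma c_sq: "c n * c n = real (N n)" by simp

lemma inv_c: "(\<lambda>n. 1 / c n) \<longlonglongrightarrow> 0"
  using tendsto_inverse_0_at_top[OF N_lim] by (simp add: inverse_eq_divide)

text \<open>The linear term of the exponent is the risk of leaving the primitive words; the
  quadratic one is the risk of hitting one of the classes used before, which grows linearly along
  the list.\<close>

lemma survival_tendsto:
  assumes m: "(\<lambda>n. real (m n) / c n) \<longlonglongrightarrow> z"
  shows "(\<lambda>n. survival \<sigma> (a n) (N n) (m n)) \<longlonglongrightarrow> exp (- (\<kappa> * z + real \<sigma> * z\<^sup>2 / 2))"
proof -
  define d where "d n = (real (N n) - real (a n)) / c n" for n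
  have d: "d \<longlonglongrightarrow> \<kappa>" unfolding d_def by (rule defect)
  \<comment> \<open>The deficit of the factor with index \<open>j\<close>: the non-primitive words
    plus the words of \<open>j\<close> used classes, relative to \<open>N\<close>.\<close>
  define e where "e n j = d n / c n + real j * real \<sigma> / real (N n)" for n j
  have e_eq: "e n j = 1 - (real (a n) - real (j * \<sigma>)) / real (N n)" for n j
  proof -
    have "d n / c n = (real (N n) - real (a n)) / real (N n)"
      unfolding d_def by (simp add: divide_divide_eq_left)
    then show ?thesis using N_pos[of n] by (simp add: e_def diff_divide_distrib)
  qed
  define \<epsilon> where "\<epsilon> n = d n * (1 / c n) + real \<sigma> * (real (m n) / c n) * (1 / c n)" for n
  have \<epsilon>: "\<epsilon> \<longlonglongrightarrow> 0"
  proof -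
    have "\<epsilon> \<longlonglongrightarrow> \<kappa> * 0 + real \<sigma> * z * 0"
      unfolding \<epsilon>_def by (intro tendsto_intros d m inv_c)
    then show ?thesis by simp
  qed
  have d0: "0 \<le> d n" for n using a_le[of n] by (simp add: d_def)
  have e\<epsilon>: "e n j \<le> \<epsilon> n" if "j < m n" for n j
  proof -
    have "real j * real \<sigma> / real (N n) \<le> real (m n) * real \<sigma> / real (N n)"
      using that by (intro divide_right_mono mult_right_mono) auto
    also have "\<dots> = real \<sigma> * (real (m n) / c n) * (1 / c n)" by simp
    finally show ?thesis by (simp add: e_def \<epsilon>_def)
  qed
  have S_eq: "(\<Sum>j<k. e n j) = d n * (real k / c n) + real \<sigma> * (real k * (real k - 1) / 2) / real (N n)" for n k
  proof -
    have "(\<Sum>j<k. u + real j * v) = u * real k + v * (real k * (real k - 1) / 2)" for u v :: real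
      by (induction k) (simp_all add: field_simps)
    from this[of "d n / c n" "real \<sigma> / real (N n)"] show ?thesis by (simp add: e_def)
  qed
  have S: "(\<lambda>n. \<Sum>j<m n. e n j) \<longlonglongrightarrow> \<kappa> * z + real \<sigma> * z\<^sup>2 / 2"
  proof -
    have "(\<Sum>j<m n. e n j) = d n * (real (m n) / c n)
        + real \<sigma> * ((real (m n) / c n) * (real (m n) / c n - 1 / c n) / 2)" for n
    proof -
      have "(real (m n) / c n) * (real (m n) / c n - 1 / c n) = real (m n) * (real (m n) - 1) / real (N n)"
        unfolding diff_divide_distrib[symmetric] times_divide_times_eq c_sq ..
      then show ?thesis unfolding S_eq by simp
    qed
    moreover have "(\<lambda>n. d n * (real (m n) / c n)
        + real \<sigma> * ((real (m n) / c n) * (real (m n) / c n - 1 / c n) / 2))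
        \<longlonglongrightarrow> \<kappa> * z + real \<sigma> * (z * (z - 0) / 2)"
      by (intro tendsto_intros d m inv_c) auto
    ultimately show ?thesis by (simp add: power2_eq_square)
  qed
  have "(\<lambda>n. \<Prod>j<m n. 1 - e n j) \<longlonglongrightarrow> exp (- (\<kappa> * z + real \<sigma> * z\<^sup>2 / 2))"
    by (rule prod_one_minus_tendsto[OF _ _ \<epsilon> S]) (use e\<epsilon> d0 in \<open>auto simp: e_def\<close>)
  \<comment> \<open>All deficits are eventually below \<open>1\<close>, so the truncated subtraction
    in \<open>survival\<close> is an ordinary one.\<close>
  moreover have "\<forall>\<^sub>F n in sequentially. (\<Prod>j<m n. 1 - e n j) = survival \<sigma> (a n) (N n) (m n)"
    using order_tendstoD(2)[OF \<epsilon>, of 1, simplified]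
  proof eventually_elim
    case (elim n)
    show ?case unfolding survival_def
    proof (rule prod.cong[OF refl])
      fix j assume "j \<in> {..<m n}"
      then have "e n j < 1" using e\<epsilon>[of j n] elim by simp
      then have "0 < (real (a n) - real (j * \<sigma>)) / real (N n)" unfolding e_eq by simp
      then have "real (j * \<sigma>) < real (a n)" using N_pos[of n] by (simp add: zero_less_divide_iff)
      then have "j * \<sigma> \<le> a n" by (simp only: of_nat_less_iff less_imp_le)
      then have "real (a n - j * \<sigma>) = real (a n) - real (j * \<sigma>)" by (rule of_nat_diff)
      then show "1 - e n j = real (a n - j * \<sigma>) / real (N n)" unfolding e_eq by simp
    qed
  qed
  ultimately show ?thesis by (rule Lim_transform_eventually)
qed

end

lemma length_weight_eq:
  "length_weight \<sigma> \<theta> l =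
     (\<Sum>s<\<sigma>. if \<theta> < real l * real (\<sigma> div gcd s \<sigma>) then 1 else 0) / (real \<sigma> * real l)"
proof -
  have "real (card (long_shifts \<sigma> \<theta> l)) = (\<Sum>s | s \<in> {..<\<sigma>} \<and> \<theta> < real l * real (\<sigma> div gcd s \<sigma>). 1)"
    by (simp add: long_shifts_def cycle_period_def)
  also have "\<dots> = (\<Sum>s<\<sigma>. if \<theta> < real l * real (\<sigma> div gcd s \<sigma>) then 1 else 0)"
    by (rule sum.inter_filter) simp
  finally show ?thesis by (simp add: length_weight_def)
qed

lemma integrable_exp_minus_Ici: "integrable lborel (\<lambda>y::real. indicator {0..} y * (C * exp (- y)))"
proof -
  have "integrable lebesgue (\<lambda>x::real. indicat_real {0..} x *\<^sub>R exp (- 1 * x))"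
    by (intro nonnegative_absolutely_integrable_1[unfolded set_integrable_def] integrable_on_exp_minus_to_infinity) auto
  then have "integrable lborel (\<lambda>x::real. indicator {0..} x * exp (- x))"
    by (subst (asm) integrable_completion) auto
  then have "integrable lborel (\<lambda>x::real. C * (indicator {0..} x * exp (- x)))"
    by (rule integrable_mult_right)
  then show ?thesis by (simp add: mult.left_commute)
qed

context scaling
begin

definition limit_weight :: "real \<Rightarrow> real \<Rightarrow> real" where
  "limit_weight x y = (\<Sum>s<\<sigma>. if x < y * real (\<sigma> div gcd s \<sigma>) then 1 else 0) / (real \<sigma> * y)"

text \<open>Exact for each \<open>n\<close>: scaling threshold and length by a common positive
  factor divides the weight by that factor.\<close>

lemma length_weight_scaled: "c n * length_weight \<sigma> (x * c n) l = limit_weight x (real l / c n)"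
proof -
  have "x * c n < real l * real (\<sigma> div gcd s \<sigma>) \<longleftrightarrow> x < real l / c n * real (\<sigma> div gcd s \<sigma>)" for s
    using c_pos[of n] by (simp add: field_simps)
  then show ?thesis unfolding length_weight_eq limit_weight_def using c_pos[of n] by simp
qed

text \<open>Each indicator jumps only where \<open>y\<close> times the order of \<open>s\<close>
  equals \<open>x\<close>, and is locally constant elsewhere.\<close>

lemma limit_weight_tendsto:
  assumes u: "u \<longlonglongrightarrow> y" and y: "y \<noteq> 0" "\<And>s. s < \<sigma> \<Longrightarrow> y * real (\<sigma> div gcd s \<sigma>) \<noteq> x"
  shows "(\<lambda>n. limit_weight x (u n)) \<longlonglongrightarrow> limit_weight x y"
  unfolding limit_weight_def
proof (intro tendsto_divide tendsto_sum tendsto_mult tendsto_const u)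
  fix s assume "s \<in> {..<\<sigma>}"
  then have s: "y * real (\<sigma> div gcd s \<sigma>) \<noteq> x" using y by simp
  let ?o = "real (\<sigma> div gcd s \<sigma>)"
  have uo: "(\<lambda>n. u n * ?o) \<longlonglongrightarrow> y * ?o" by (intro tendsto_intros u)
  have "\<forall>\<^sub>F n in sequentially. (x < u n * ?o) = (x < y * ?o)"
  proof (cases "x < y * ?o")
    case True
    show ?thesis using order_tendstoD(1)[OF uo True] by eventually_elim (use True in simp)
  next
    case False
    then have "y * ?o < x" using s by simp
    from order_tendstoD(2)[OF uo this] show ?thesis by eventually_elim (use False in simp)
  qed
  then have "\<forall>\<^sub>F n in sequentially. (if x < y * ?o then 1 else 0) = (if x < u n * ?o then 1 else 0 :: real)"
    by eventually_elim simp
  then show "(\<lambda>n. if x < u n * ?o then 1 else 0 :: real) \<longlonglongrightarrow> (if x < y * ?o then 1 else 0)"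
    by (rule Lim_transform_eventually[OF tendsto_const])
qed (use y \<sigma> in auto)

lemma floor_scaled_tendsto: "(\<lambda>n. real (nat \<lfloor>y * c n\<rfloor> + 1) / c n) \<longlonglongrightarrow> y" if "y \<ge> 0"
proof (rule tendsto_sandwich)
  show "\<forall>\<^sub>F n in sequentially. y \<le> real (nat \<lfloor>y * c n\<rfloor> + 1) / c n"
  proof (intro always_eventually allI)
    fix n
    have "y * c n \<le> real (nat \<lfloor>y * c n\<rfloor> + 1)" by linarith
    then show "y \<le> real (nat \<lfloor>y * c n\<rfloor> + 1) / c n" using c_pos[of n] by (simp add: le_divide_eq)
  qed
  show "\<forall>\<^sub>F n in sequentially. real (nat \<lfloor>y * c n\<rfloor> + 1) / c n \<le> y + 1 / c n"
  proof (intro always_eventually allI)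
    fix n
    have "0 \<le> y * c n" using that c_pos[of n] by simp
    then have "real (nat \<lfloor>y * c n\<rfloor> + 1) \<le> y * c n + 1" by linarith
    then have "real (nat \<lfloor>y * c n\<rfloor> + 1) / c n \<le> (y * c n + 1) / c n"
      using c_pos[of n] by (intro divide_right_mono) auto
    then show "real (nat \<lfloor>y * c n\<rfloor> + 1) / c n \<le> y + 1 / c n"
      using c_pos[of n] N_pos[of n] by (simp add: add_divide_distrib)
  qed
  show "(\<lambda>n. y + 1 / c n) \<longlonglongrightarrow> y" using tendsto_add[OF tendsto_const inv_c] by simp
qed simp

lemma floor_scaled_le:
  assumes "y \<ge> 0"
  shows "\<forall>\<^sub>F n in sequentially. nat \<lfloor>y * c n\<rfloor> + 1 \<le> N n"
proof -
  have "\<forall>\<^sub>F n in sequentially. y + 1 \<le> c n"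
    using N_lim by (auto simp: filterlim_at_top)
  then show ?thesis
  proof eventually_elim
    case (elim n)
    have "0 \<le> y * c n" using assms c_pos[of n] by simp
    then have "real (nat \<lfloor>y * c n\<rfloor> + 1) \<le> y * c n + 1" by linarith
    also have "\<dots> \<le> y * c n + c n" using elim assms by linarith
    also have "\<dots> = (y + 1) * c n" by (simp add: distrib_right)
    also have "\<dots> \<le> c n * c n" using elim c_pos[of n] by (intro mult_right_mono) auto
    finally show ?case by simp
  qed
qed

text \<open>Convergence is claimed along every sequence with \<open>m n / c n\<close> tending to
  \<open>z\<close>, because the induction step needs it at \<open>m n\<close> plus a length that
  itself varies with \<open>n\<close>. Measurability of \<open>g\<close> is carried along so that
  the limit of the next order can be written as an integral.\<close>

lemma moment_tendsto:
  assumes x: "x > 0"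
  shows "\<exists>g \<in> borel_measurable borel. \<forall>z\<ge>0. \<forall>m. (\<lambda>n. real (m n) / c n) \<longlonglongrightarrow> z \<longrightarrow>
     (\<lambda>n. moment \<sigma> (a n) (N n) (x * c n) k (m n)) \<longlonglongrightarrow> g z"
proof (induction k)
  case 0
  show ?case
    by (rule bexI[of _ "\<lambda>z. exp (- (\<kappa> * z + real \<sigma> * z\<^sup>2 / 2))"]) (simp only: moment.simps, blast intro: survival_tendsto, measurable)
next
  case (Suc k)
  then obtain g where g[measurable]: "g \<in> borel_measurable borel" and
    lim: "\<And>z m. z \<ge> 0 \<Longrightarrow> (\<lambda>n. real (m n) / c n) \<longlonglongrightarrow> z \<Longrightarrow>
       (\<lambda>n. moment \<sigma> (a n) (N n) (x * c n) k (m n)) \<longlonglongrightarrow> g z"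
    by blast
  have lw[measurable]: "limit_weight x \<in> borel_measurable borel"
    unfolding limit_weight_def by measurable
  define f where "f z y = indicator {0..} y * (limit_weight x y * g (z + y))" for z y :: real
  show ?case
  proof (intro bexI[of _ "\<lambda>z. LINT y|lborel. f z y"] allI impI)
    show "(\<lambda>z. LINT y|lborel. f z y) \<in> borel_measurable borel"
      unfolding f_def by measurable
    fix z :: real and m
    assume z: "z \<ge> 0" and m: "(\<lambda>n. real (m n) / c n) \<longlonglongrightarrow> z"
    define G where "G n l = length_weight \<sigma> (x * c n) l * moment \<sigma> (a n) (N n) (x * c n) k (m n + l)" for n l
    define s where "s n y = (\<Sum>l=1..N n. c n * G n l * indicator {(real l - 1) / c n..<real l / c n} y)" for n y
    define L where "L n y = nat \<lfloor>y * c n\<rfloor> + 1" for n y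
    have s_eq: "s n y = (if 0 \<le> y \<and> L n y \<le> N n then
        limit_weight x (real (L n y) / c n) * moment \<sigma> (a n) (N n) (x * c n) k (m n + L n y) else 0)" for n y
      unfolding s_def sum_steps_eq[OF c_pos] L_def G_def
      by (simp add: length_weight_scaled flip: mult.assoc)
    have s_int: "moment \<sigma> (a n) (N n) (x * c n) (Suc k) (m n) = (LINT y|lborel. s n y)" for n
      unfolding s_def sum_eq_integral_steps[OF c_pos, symmetric] by (simp add: G_def)
    let ?B = "exp 2 * real \<sigma> / x"
    \<comment> \<open>The factor \<open>\<sigma> / x\<close> bounds the scaled weight, and the rest
      is \<open>moment_le_exp\<close> evaluated with
      \<open>y \<le> (m n + L n y) / c n\<close>.\<close>
    let ?w = "\<lambda>y. indicator {0..} y * ((real \<sigma> / x * exp 2 * ?B ^ k) * exp (- y)) :: real"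
    have bound: "norm (s n y) \<le> ?w y" for n y
    proof (cases "0 \<le> y \<and> L n y \<le> N n")
      case True
      have nn: "0 \<le> c n * length_weight \<sigma> (x * c n) (L n y)"
        using c_pos[of n] by (intro mult_nonneg_nonneg length_weight_nonneg) auto
      have "c n * length_weight \<sigma> (x * c n) (L n y) \<le> c n * (real \<sigma> / (x * c n))"
        using c_pos[of n] x \<sigma> by (intro mult_left_mono length_weight_le) auto
      also have "\<dots> = real \<sigma> / x" using c_pos[of n] N_pos[of n] by simp
      finally have 1: "limit_weight x (real (L n y) / c n) \<le> real \<sigma> / x" unfolding length_weight_scaled .
      have "y * c n \<le> real (m n + L n y)" unfolding L_def by linarith
      then have y: "y \<le> real (m n + L n y) / c n" using c_pos[of n] by (simp add: le_divide_eq)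
      have "moment \<sigma> (a n) (N n) (x * c n) k (m n + L n y) \<le> exp (2 - real (m n + L n y) / c n) * ?B ^ k"
        by (rule moment_le_exp[OF a_le \<sigma> N_pos x])
      also have "\<dots> \<le> (exp 2 * exp (- y)) * ?B ^ k"
        using y x by (intro mult_right_mono) (auto simp flip: exp_add)
      finally have 2: "moment \<sigma> (a n) (N n) (x * c n) k (m n + L n y) \<le> (exp 2 * exp (- y)) * ?B ^ k" .
      have "s n y \<le> real \<sigma> / x * ((exp 2 * exp (- y)) * ?B ^ k)"
      proof -
        have "s n y = limit_weight x (real (L n y) / c n) * moment \<sigma> (a n) (N n) (x * c n) k (m n + L n y)"
          using True by (simp add: s_eq)
        also have "\<dots> \<le> real \<sigma> / x * ((exp 2 * exp (- y)) * ?B ^ k)"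
          by (rule mult_mono[OF 1 2]) (use x in \<open>auto simp: moment_nonneg\<close>)
        finally show ?thesis .
      qed
      moreover have "0 \<le> s n y"
        unfolding s_eq using True nn by (auto simp: moment_nonneg length_weight_scaled)
      ultimately show ?thesis using True by (simp add: algebra_simps)
    next
      case False
      then have "s n y = 0" unfolding s_eq by (rule if_not_P)
      then show ?thesis using x by (simp add: indicator_def)
    qed
    \<comment> \<open>The finitely many points where \<open>limit_weight\<close> jumps, and
      \<open>0\<close>, where it divides by zero.\<close>
    define E where "E = insert 0 ((\<lambda>s. x / real (\<sigma> div gcd s \<sigma>)) ` {..<\<sigma>})"
    have ptw: "(\<lambda>n. s n y) \<longlonglongrightarrow> f z y" if "y \<notin> E" for y
    proof (cases "0 \<le> y")
      case True
      have ne: "y \<noteq> 0" "y * real (\<sigma> div gcd s \<sigma>) \<noteq> x" if "s < \<sigma>" for s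
      proof -
        show "y \<noteq> 0" using \<open>y \<notin> E\<close> by (auto simp: E_def)
        have "y \<noteq> x / real (\<sigma> div gcd s \<sigma>)" using \<open>y \<notin> E\<close> that by (auto simp: E_def)
        moreover have "real (\<sigma> div gcd s \<sigma>) \<noteq> 0"
          using \<sigma> by (auto simp: div_eq_0_iff not_less dvd_imp_le)
        ultimately show "y * real (\<sigma> div gcd s \<sigma>) \<noteq> x" by (auto simp: eq_divide_eq)
      qed
      have Ly: "(\<lambda>n. real (L n y) / c n) \<longlonglongrightarrow> y" unfolding L_def by (rule floor_scaled_tendsto[OF True])
      have "(\<lambda>n. real (m n) / c n + real (L n y) / c n) \<longlonglongrightarrow> z + y" by (intro tendsto_add m Ly)
      then have "(\<lambda>n. real (m n + L n y) / c n) \<longlonglongrightarrow> z + y" by (simp add: add_divide_distrib)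
      then have "(\<lambda>n. moment \<sigma> (a n) (N n) (x * c n) k (m n + L n y)) \<longlonglongrightarrow> g (z + y)"
        using z True by (intro lim) auto
      moreover have "(\<lambda>n. limit_weight x (real (L n y) / c n)) \<longlonglongrightarrow> limit_weight x y"
        using ne \<sigma> by (intro limit_weight_tendsto Ly) auto
      ultimately have "(\<lambda>n. limit_weight x (real (L n y) / c n) *
          moment \<sigma> (a n) (N n) (x * c n) k (m n + L n y)) \<longlonglongrightarrow> limit_weight x y * g (z + y)"
        by (rule tendsto_mult[rotated])
      moreover have "\<forall>\<^sub>F n in sequentially. limit_weight x (real (L n y) / c n) *
          moment \<sigma> (a n) (N n) (x * c n) k (m n + L n y) = s n y"
        using floor_scaled_le[OF True] by eventually_elim (use True in \<open>simp add: s_eq L_def\<close>)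
      ultimately have "(\<lambda>n. s n y) \<longlonglongrightarrow> limit_weight x y * g (z + y)" by (rule Lim_transform_eventually)
      then show ?thesis using True by (simp add: f_def)
    qed (simp add: s_eq f_def)
    have "(\<lambda>n. LINT y|lborel. s n y) \<longlonglongrightarrow> (LINT y|lborel. f z y)"
    proof (rule integral_dominated_convergence[where w = ?w])
      show "f z \<in> borel_measurable lborel" unfolding f_def by measurable
      show "s n \<in> borel_measurable lborel" for n unfolding s_def by measurable
      show "integrable lborel ?w" by (rule integrable_exp_minus_Ici)
      show "AE y in lborel. norm (s n y) \<le> ?w y" for n using bound by simp
      have "E \<in> null_sets lborel" by (rule finite_imp_null_set_lborel) (simp add: E_def)
      then have "AE y in lborel. y \<notin> E" by (rule AE_not_in)
      then show "AE y in lborel. (\<lambda>n. s n y) \<longlonglongrightarrow> f z y"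
        by eventually_elim (rule ptw)
    qed
    then show "(\<lambda>n. moment \<sigma> (a n) (N n) (x * c n) (Suc k) (m n)) \<longlonglongrightarrow> (LINT y|lborel. f z y)"
      unfolding s_int .
  qed
qed

lemma moment_0_convergent:
  assumes "x > 0"
  shows "convergent (\<lambda>n. moment \<sigma> (a n) (N n) (x * c n) k 0)"
proof -
  obtain g where "\<And>z m. z \<ge> 0 \<Longrightarrow> (\<lambda>n. real (m n) / c n) \<longlonglongrightarrow> z \<Longrightarrow>
       (\<lambda>n. moment \<sigma> (a n) (N n) (x * c n) k (m n)) \<longlonglongrightarrow> g z"
    using moment_tendsto[OF assms, of k] by blast
  from this[of 0 "\<lambda>_. 0"] show ?thesis by (auto simp: convergent_def)
qed

lemma moment_0_le:
  assumes "x > 0"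
  shows "moment \<sigma> (a n) (N n) (x * c n) k 0 \<le> exp 2 * (exp 2 * real \<sigma> / x) ^ k"
  using moment_le_exp[OF a_le \<sigma> N_pos assms, of n k 0] by simp

lemma alternating_moments_convergent:
  assumes x: "x > 0"
  shows "convergent (\<lambda>n. \<Sum>k. (-1) ^ k * (moment \<sigma> (a n) (N n) (x * c n) k 0 / fact k))"
proof -
  let ?B = "exp 2 * real \<sigma> / x"
  define b where "b k = lim (\<lambda>n. moment \<sigma> (a n) (N n) (x * c n) k 0)" for k
  have b: "(\<lambda>n. moment \<sigma> (a n) (N n) (x * c n) k 0) \<longlonglongrightarrow> b k" for k
    using moment_0_convergent[OF x] unfolding b_def by (simp add: convergent_LIMSEQ_iff)
  have "(\<lambda>n. \<Sum>k. (-1) ^ k * (moment \<sigma> (a n) (N n) (x * c n) k 0 / fact k)) \<longlonglongrightarrow> (\<Sum>k. (-1) ^ k * (b k / fact k))"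
  proof (rule tannerys_theorem[THEN conjunct2, THEN conjunct2])
    show "(\<lambda>n. (-1) ^ k * (moment \<sigma> (a n) (N n) (x * c n) k 0 / fact k)) \<longlonglongrightarrow> (-1) ^ k * (b k / fact k)" for k
      by (intro tendsto_intros b) simp
    show "\<forall>\<^sub>F (k, n) in sequentially \<times>\<^sub>F sequentially.
        norm ((-1) ^ k * (moment \<sigma> (a n) (N n) (x * c n) k 0 / fact k)) \<le> exp 2 * (inverse (fact k) * ?B ^ k)"
    proof (intro always_eventually allI, clarify)
      fix k n
      have "moment \<sigma> (a n) (N n) (x * c n) k 0 / fact k \<le> (exp 2 * ?B ^ k) / fact k"
        by (intro divide_right_mono moment_0_le x) simp
      then show "norm ((-1) ^ k * (moment \<sigma> (a n) (N n) (x * c n) k 0 / fact k)) \<le> exp 2 * (inverse (fact k) * ?B ^ k)"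
        by (simp add: abs_mult moment_nonneg field_simps)
    qed
    show "summable (\<lambda>k. exp 2 * (inverse (fact k) * ?B ^ k))"
      by (intro summable_mult summable_exp)
  qed simp
  then show ?thesis by (auto simp: convergent_def)
qed

end

subsection \<open>Convergence of the scaled period\<close>

lemma concat_replicate_words:
  assumes "w \<in> words n m" "k > 0"
  shows "concat (replicate k w) \<in> words n (k * m)"
  using assms by (auto simp: words_def length_concat sum_list_replicate)

lemma inj_on_concat_replicate:
  assumes "k > 0"
  shows "inj_on (\<lambda>w. concat (replicate k w)) (words n m)"
proof (rule inj_onI)
  fix v w assume vw: "v \<in> words n m" "w \<in> words n m" "concat (replicate k v) = concat (replicate k w)"
  obtain j where "k = Suc j" using assms by (cases k) auto
  then show "v = w" using vw by (simp add: words_def)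
qed

text \<open>A non-primitive word is a \<open>k\<close>-th power with \<open>k \<ge> 2\<close>.
  Squares exist for even \<sigma> and form the main term \<open>E\<close>; the higher powers give at
  most \<open>n ^ (\<sigma> div 3)\<close> words for each \<open>k\<close>.\<close>

lemma card_nonprimitive_bounds:
  assumes \<sigma>: "\<sigma> > 0" and n: "n > 0"
  defines "E \<equiv> (if even \<sigma> then n ^ (\<sigma> div 2) else 0)"
  shows "E \<le> n ^ \<sigma> - card (pwords n \<sigma>)" "n ^ \<sigma> - card (pwords n \<sigma>) \<le> E + \<sigma> * n ^ (\<sigma> div 3)"
proof -
  define Q where "Q = words n \<sigma> - pwords n \<sigma>"
  define R where "R k = (\<lambda>w. concat (replicate k w)) ` words n (\<sigma> div k)" for k
  have finR: "finite (R k)" for k by (simp add: R_def finite_words)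
  have cR: "card (R k) = n ^ (\<sigma> div k)" if "k > 0" for k
    unfolding R_def using that by (simp add: card_image inj_on_concat_replicate card_words)
  have cQ: "card Q = n ^ \<sigma> - card (pwords n \<sigma>)"
    unfolding Q_def by (subst card_Diff_subset) (auto simp: pwords_def finite_words card_words)
  have finQ: "finite Q" by (simp add: Q_def finite_words)
  have sub: "R k \<subseteq> Q" if "k dvd \<sigma>" "2 \<le> k" for k
  proof
    fix x assume "x \<in> R k"
    then obtain w where w: "w \<in> words n (\<sigma> div k)" "x = concat (replicate k w)" by (auto simp: R_def)
    have "x \<in> words n (k * (\<sigma> div k))" using w that concat_replicate_words[OF w(1), of k] by simp
    moreover have "\<not> primitive_word x" unfolding primitive_word_def using w(2) that(2) by blast
    ultimately show "x \<in> Q" using that by (simp add: Q_def pwords_def)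
  qed
  show "E \<le> n ^ \<sigma> - card (pwords n \<sigma>)"
    using card_mono[OF finQ sub[of 2]] cR[of 2] unfolding E_def cQ[symmetric] by auto
  \<comment> \<open>Exponents \<open>k\<close> that do not divide \<sigma> are harmless extra sets
    here; the upper bound uses only \<open>\<sigma> div k \<le> \<sigma> div 3\<close>.\<close>
  have "Q \<subseteq> (if even \<sigma> then R 2 else {}) \<union> (\<Union>k\<in>{3..\<sigma>}. R k)"
  proof
    fix x assume x: "x \<in> Q"
    then obtain w k where wk: "k \<ge> 2" "x = concat (replicate k w)" "length x = \<sigma>" "set x \<subseteq> {..<n}"
      by (auto simp: Q_def pwords_def words_def primitive_word_def)
    have len: "\<sigma> = k * length w" using wk by (simp add: length_concat sum_list_replicate)
    have "set w \<subseteq> set x" using wk by (cases k) auto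
    moreover have "\<sigma> div k = length w" using len wk(1) by simp
    ultimately have "w \<in> words n (\<sigma> div k)" using wk(4) by (auto simp: words_def)
    then have xR: "x \<in> R k" using wk by (auto simp: R_def)
    have "k \<le> \<sigma>" using len \<sigma> by (cases "length w") auto
    show "x \<in> (if even \<sigma> then R 2 else {}) \<union> (\<Union>k\<in>{3..\<sigma>}. R k)"
    proof (cases "k = 2")
      case True
      then show ?thesis using xR len by simp
    next
      case False
      then have "k \<in> {3..\<sigma>}" using wk(1) \<open>k \<le> \<sigma>\<close> by simp
      then show ?thesis using xR by blast
    qed
  qed
  then have "card Q \<le> card ((if even \<sigma> then R 2 else {}) \<union> (\<Union>k\<in>{3..\<sigma>}. R k))"
    by (rule card_mono[rotated]) (simp add: finR)
  also have "\<dots> \<le> card (if even \<sigma> then R 2 else {}) + card (\<Union>k\<in>{3..\<sigma>}. R k)" by (rule card_Un_le)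
  also have "card (if even \<sigma> then R 2 else {}) = E" by (simp add: E_def cR)
  also have "card (\<Union>k\<in>{3..\<sigma>}. R k) \<le> (\<Sum>k\<in>{3..\<sigma>}. card (R k))" by (rule card_UN_le) simp
  also have "(\<Sum>k\<in>{3..\<sigma>}. card (R k)) \<le> (\<Sum>k\<in>{3..\<sigma>}. n ^ (\<sigma> div 3))"
    using n by (intro sum_mono) (auto simp: cR intro!: power_increasing div_le_mono2)
  also have "\<dots> \<le> \<sigma> * n ^ (\<sigma> div 3)" by simp
  finally show "n ^ \<sigma> - card (pwords n \<sigma>) \<le> E + \<sigma> * n ^ (\<sigma> div 3)" unfolding cQ by simp
qed

text \<open>Squares are the only non-primitive words numerous enough to be seen on the scale
  \<open>sqrt N\<close>, whence the value of \<kappa>. Passing to \<open>Suc n\<close> keeps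
  \<open>N\<close> positive.\<close>

lemma scaling_pwords:
  assumes \<sigma>: "\<sigma> > 0"
  shows "scaling \<sigma> (\<lambda>n. card (pwords (Suc n) \<sigma>)) (\<lambda>n. Suc n ^ \<sigma>) (if even \<sigma> then 1 else 0)"
proof
  let ?c = "\<lambda>n. sqrt (real (Suc n ^ \<sigma>))"
  define D where "D n = real (Suc n ^ \<sigma>) - real (card (pwords (Suc n) \<sigma>))" for n
  define E where "E n = (if even \<sigma> then Suc n ^ (\<sigma> div 2) else 0)" for n
  let ?\<kappa> = "if even \<sigma> then 1 else 0 :: real"
  have c0: "?c n > 0" for n by simp
  have sqrt_lim: "filterlim (\<lambda>n. sqrt (real (Suc n))) at_top sequentially"
    by (rule filterlim_compose[OF sqrt_at_top])
      (rule filterlim_compose[OF filterlim_real_sequentially filterlim_Suc])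
  show "filterlim ?c at_top sequentially"
  proof (rule filterlim_at_top_mono[OF sqrt_lim], intro always_eventually allI)
    fix n
    have "Suc n ^ 1 \<le> Suc n ^ \<sigma>" using \<sigma> by (intro power_increasing) auto
    then show "sqrt (real (Suc n)) \<le> ?c n" by (intro real_sqrt_le_mono of_nat_mono) simp
  qed
  have D: "D n = real (Suc n ^ \<sigma> - card (pwords (Suc n) \<sigma>))" for n
    unfolding D_def using card_pwords_le[of "Suc n" \<sigma>] by (rule of_nat_diff[symmetric])
  have E: "real (E n) / ?c n = ?\<kappa>" for n
  proof (cases "even \<sigma>")
    case True
    then obtain h where h: "\<sigma> = 2 * h" by (elim evenE)
    have "?c n = sqrt ((real (Suc n) ^ h)\<^sup>2)" unfolding h of_nat_power by (simp add: power_mult[symmetric] mult.commute)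
    also have "\<dots> = real (Suc n) ^ h" by (rule real_sqrt_unique) simp_all
    finally show ?thesis by (simp add: E_def h)
  qed (simp add: E_def)
  show "(\<lambda>n. (real (Suc n ^ \<sigma>) - real (card (pwords (Suc n) \<sigma>))) / ?c n) \<longlonglongrightarrow> ?\<kappa>"
    unfolding D_def[symmetric]
  proof (rule tendsto_sandwich)
    show "\<forall>\<^sub>F n in sequentially. ?\<kappa> \<le> D n / ?c n"
    proof (intro always_eventually allI)
      fix n
      have "real (E n) \<le> D n" unfolding D E_def
        by (intro of_nat_mono card_nonprimitive_bounds(1)[OF \<sigma>]) simp
      then show "?\<kappa> \<le> D n / ?c n" unfolding E[of n, symmetric] by (intro divide_right_mono) auto
    qed
    show "\<forall>\<^sub>F n in sequentially. D n / ?c n \<le> ?\<kappa> + real \<sigma> * (1 / sqrt (real (Suc n)))"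
    proof (intro always_eventually allI)
      fix n
      let ?d = "\<sigma> div 3"
      have "D n \<le> real (E n + \<sigma> * Suc n ^ ?d)" unfolding D E_def
        by (intro of_nat_mono card_nonprimitive_bounds(2)[OF \<sigma>]) simp
      then have "D n / ?c n \<le> real (E n + \<sigma> * Suc n ^ ?d) / ?c n" by (intro divide_right_mono) auto
      also have "\<dots> = ?\<kappa> + real \<sigma> * (real (Suc n) ^ ?d / ?c n)"
        using E[of n] by (simp add: add_divide_distrib)
      also have "real (Suc n) ^ ?d / ?c n \<le> 1 / sqrt (real (Suc n))"
      proof -
        \<comment> \<open>The surplus of one makes \<open>n ^ (\<sigma> div 3)\<close> smaller than
          the scale by a factor of at least \<open>sqrt n\<close>, where \<open>n\<close> stands for
          \<open>Suc n\<close>.\<close>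
        have "?d * 2 + 1 \<le> \<sigma>" using \<sigma> by linarith
        then have "Suc n ^ (?d * 2 + 1) \<le> Suc n ^ \<sigma>" by (intro power_increasing) auto
        then have "real (Suc n ^ (?d * 2 + 1)) \<le> real (Suc n ^ \<sigma>)" by (rule of_nat_mono)
        then have "sqrt ((real (Suc n) ^ ?d)\<^sup>2 * real (Suc n)) \<le> ?c n"
          by (intro real_sqrt_le_mono) (simp only: of_nat_mult of_nat_power power_add power_mult power_one_right)
        then have "real (Suc n) ^ ?d * sqrt (real (Suc n)) \<le> ?c n"
          by (simp add: real_sqrt_mult)
        then show ?thesis using c0[of n] by (simp add: field_simps)
      qed
      finally show "D n / ?c n \<le> ?\<kappa> + real \<sigma> * (1 / sqrt (real (Suc n)))"
        by (simp add: mult_left_mono)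
    qed
    have "(\<lambda>n. 1 / sqrt (real (Suc n))) \<longlonglongrightarrow> 0"
      using tendsto_inverse_0_at_top[OF sqrt_lim] by (simp add: inverse_eq_divide)
    then have "(\<lambda>n. ?\<kappa> + real \<sigma> * (1 / sqrt (real (Suc n)))) \<longlonglongrightarrow> ?\<kappa> + real \<sigma> * 0"
      by (intro tendsto_intros)
    then show "(\<lambda>n. ?\<kappa> + real \<sigma> * (1 / sqrt (real (Suc n)))) \<longlonglongrightarrow> ?\<kappa>" by simp
  qed simp
qed (use \<sigma> card_pwords_le in auto)

section \<open>Weak convergence of the scaled period\<close>

text \<open>Tightness supplies a subsequential limit \<open>M\<close>, and convergence of the whole
  sequence at \<open>x\<close> forces the value \<open>cdf M x\<close> at continuity points other
  than \<open>x0\<close>. At \<open>x0\<close> itself, monotonicity squeezes the values between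
  nearby continuity points, which are dense.\<close>

lemma tight_cdf_convergent_imp_weak_conv:
  assumes tight: "tight \<mu>" and conv: "\<And>x. x \<noteq> x0 \<Longrightarrow> convergent (\<lambda>n. cdf (\<mu> n) x)"
  shows "\<exists>M. real_distribution M \<and> weak_conv_m \<mu> M"
proof -
  interpret \<mu>: real_distribution "\<mu> n" for n using tight by (simp add: tight_def)
  obtain \<rho> M where \<rho>: "strict_mono (\<rho> :: nat \<Rightarrow> nat)" and M: "real_distribution M"
    and wc: "weak_conv_m (\<mu> \<circ> id \<circ> \<rho>) M"
    using tight_imp_convergent_subsubsequence[OF tight strict_mono_id] by blast
  interpret M: real_distribution M by (rule M)
  have mono: "mono (cdf M)" by (intro monoI M.cdf_nondecreasing)
  have lim: "(\<lambda>n. cdf (\<mu> n) x) \<longlonglongrightarrow> cdf M x" if x: "x \<noteq> x0" "isCont (cdf M) x" for x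
  proof -
    obtain l where l: "(\<lambda>n. cdf (\<mu> n) x) \<longlonglongrightarrow> l" using conv[OF x(1)] by (auto simp: convergent_def)
    have "(\<lambda>n. cdf (\<mu> (\<rho> n)) x) \<longlonglongrightarrow> cdf M x"
      using wc x(2) by (simp add: weak_conv_m_def weak_conv_def)
    moreover have "(\<lambda>n. cdf (\<mu> (\<rho> n)) x) \<longlonglongrightarrow> l"
      using LIMSEQ_subseq_LIMSEQ[OF l \<rho>] by (simp add: comp_def)
    ultimately show ?thesis using l LIMSEQ_unique by blast
  qed
  have lim0: "(\<lambda>n. cdf (\<mu> n) x0) \<longlonglongrightarrow> cdf M x0" if cont: "isCont (cdf M) x0"
  proof (rule order_tendstoI)
    fix u assume u: "u < cdf M x0"
    have "\<forall>\<^sub>F y in at x0. u < cdf M y"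
      using cont u by (intro order_tendstoD) (auto simp: isCont_def)
    then obtain d where d: "d > 0" "\<And>y. y \<noteq> x0 \<Longrightarrow> dist y x0 < d \<Longrightarrow> u < cdf M y"
      by (auto simp: eventually_at)
    obtain y where y: "y \<in> {x0 - d<..<x0}" "isCont (cdf M) y"
      using open_minus_countable[OF mono_ctble_discont[OF mono], of "{x0 - d<..<x0}"] d(1) by auto
    have "\<forall>\<^sub>F n in sequentially. u < cdf (\<mu> n) y"
      using lim[OF _ y(2)] d(2)[of y] y(1) by (intro order_tendstoD) (auto simp: dist_real_def)
    moreover have "cdf (\<mu> n) y \<le> cdf (\<mu> n) x0" for n
      using y(1) by (intro \<mu>.cdf_nondecreasing) simp
    ultimately show "\<forall>\<^sub>F n in sequentially. u < cdf (\<mu> n) x0"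
      by (auto elim!: eventually_mono intro: less_le_trans)
  next
    fix u assume u: "cdf M x0 < u"
    have "\<forall>\<^sub>F y in at x0. cdf M y < u"
      using cont u by (intro order_tendstoD) (auto simp: isCont_def)
    then obtain d where d: "d > 0" "\<And>y. y \<noteq> x0 \<Longrightarrow> dist y x0 < d \<Longrightarrow> cdf M y < u"
      by (auto simp: eventually_at)
    obtain y where y: "y \<in> {x0<..<x0 + d}" "isCont (cdf M) y"
      using open_minus_countable[OF mono_ctble_discont[OF mono], of "{x0<..<x0 + d}"] d(1) by auto
    have "\<forall>\<^sub>F n in sequentially. cdf (\<mu> n) y < u"
      using lim[OF _ y(2)] d(2)[of y] y(1) by (intro order_tendstoD) (auto simp: dist_real_def)
    moreover have "cdf (\<mu> n) x0 \<le> cdf (\<mu> n) y" for n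
      using y(1) by (intro \<mu>.cdf_nondecreasing) simp
    ultimately show "\<forall>\<^sub>F n in sequentially. cdf (\<mu> n) x0 < u"
      by (auto elim!: eventually_mono intro: le_less_trans)
  qed
  have "weak_conv_m \<mu> M"
    unfolding weak_conv_m_def weak_conv_def
  proof (intro allI impI)
    fix x assume "isCont (cdf M) x"
    then show "(\<lambda>n. cdf (\<mu> n) x) \<longlonglongrightarrow> cdf M x"
      by (cases "x = x0") (simp_all add: lim lim0)
  qed
  with M show ?thesis by blast
qed

text \<open>For \<open>n = 0\<close> and \<open>r > 0\<close> there is exactly one rule, the empty
  function, so the laws are probability measures at every index.\<close>

lemma card_rules_gt_0: "r > 0 \<Longrightarrow> card (rules r n) > 0"
  by (cases "n = 0") (auto simp: card_rules)

lemma real_distribution_scaled_period_law: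
  assumes "r > 0"
  shows "real_distribution (scaled_period_law r \<sigma> n)"
proof -
  interpret prob_space "uniform_count_measure (rules r n)"
    using card_rules_gt_0[OF assms, of n] by (intro prob_space_uniform_count_measure) auto
  show ?thesis unfolding scaled_period_law_def
    by (rule real_distribution_distr) (simp add: measurable_def sets_uniform_count_measure space_uniform_count_measure)
qed

lemma cdf_scaled_period_law:
  assumes "r > 0"
  shows "cdf (scaled_period_law r \<sigma> n) x =
    real (card {f \<in> rules r n. real (longest_period r \<sigma> n f) / real n powr (real \<sigma> / 2) \<le> x}) / real (card (rules r n))"
proof -
  let ?X = "\<lambda>f. real (longest_period r \<sigma> n f) / real n powr (real \<sigma> / 2)"
  have "?X \<in> measurable (uniform_count_measure (rules r n)) borel"
    by (simp add: measurable_def sets_uniform_count_measure space_uniform_count_measure)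
  then have "cdf (scaled_period_law r \<sigma> n) x
      = measure (uniform_count_measure (rules r n)) (?X -` {..x} \<inter> space (uniform_count_measure (rules r n)))"
    unfolding scaled_period_law_def cdf_def by (intro measure_distr) auto
  also have "?X -` {..x} \<inter> space (uniform_count_measure (rules r n)) = {f \<in> rules r n. ?X f \<le> x}"
    by (auto simp: space_uniform_count_measure)
  finally show ?thesis by (simp add: measure_uniform_count_measure)
qed

lemma powr_half_eq_sqrt: "n > 0 \<Longrightarrow> real n powr (real \<sigma> / 2) = sqrt (real (n ^ \<sigma>))"
  by (simp add: powr_half_sqrt[symmetric] powr_powr flip: powr_realpow)

lemma cdf_scaled_period_law_tail:
  assumes "r > 0" "n > 0"
  shows "cdf (scaled_period_law r \<sigma> n) x = 1 - tail_prob r \<sigma> n (x * sqrt (real (n ^ \<sigma>)))"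
proof -
  let ?c = "sqrt (real (n ^ \<sigma>))"
  have c: "?c > 0" using assms by simp
  define A where "A = {f \<in> rules r n. x * ?c < real (longest_period r \<sigma> n f)}"
  have "{f \<in> rules r n. real (longest_period r \<sigma> n f) / real n powr (real \<sigma> / 2) \<le> x} = rules r n - A"
    unfolding A_def powr_half_eq_sqrt[OF assms(2)] using c by (auto simp: divide_le_eq not_less)
  moreover have "real (card (rules r n - A)) = real (card (rules r n)) - real (card A)"
  proof -
    have "A \<subseteq> rules r n" by (auto simp: A_def)
    then show ?thesis
      by (simp add: card_Diff_subset finite_subset of_nat_diff card_mono)
  qed
  ultimately show ?thesis
    unfolding cdf_scaled_period_law[OF assms(1)] tail_prob_def A_def[symmetric]
    using card_rules_gt_0[OF assms(1), of n] by (auto simp: diff_divide_distrib)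
qed

lemma cdf_scaled_period_law_neg:
  assumes "r > 0" "x < 0"
  shows "cdf (scaled_period_law r \<sigma> n) x = 0"
proof -
  have "{f \<in> rules r n. real (longest_period r \<sigma> n f) / real n powr (real \<sigma> / 2) \<le> x} = {}"
    using assms(2) by (auto simp: not_le intro: less_le_trans)
  then show ?thesis by (simp only: cdf_scaled_period_law[OF assms(1)] card.empty of_nat_0 div_0)
qed

text \<open>Tightness quantifies over all \<open>n\<close>, and the moment bounds start at
  \<open>n = 1\<close>; with no states there are no periods.\<close>

lemma cdf_scaled_period_law_0:
  assumes "r > 0" "\<sigma> > 0" "x \<ge> 0"
  shows "cdf (scaled_period_law r \<sigma> 0) x = 1"
proof -
  have "words 0 \<sigma> = {}" using assms(2) by (auto simp: words_def)
  then have "longest_period r \<sigma> 0 f = 0" for f by (simp add: longest_period_def temporal_periods_def)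
  then show ?thesis
    unfolding cdf_scaled_period_law[OF assms(1)] using assms card_rules_gt_0[OF assms(1), of 0] by auto
qed

lemma tight_scaled_period_law:
  assumes "0 < \<sigma>" "\<sigma> \<le> r"
  shows "tight (scaled_period_law r \<sigma>)"
  unfolding tight_def
proof (intro conjI allI impI)
  have r: "r > 0" using assms by simp
  show rd: "real_distribution (scaled_period_law r \<sigma> n)" for n
    by (rule real_distribution_scaled_period_law[OF r])
  fix \<epsilon> :: real assume \<epsilon>: "\<epsilon> > 0"
  \<comment> \<open>Chosen so that the bound on the mean number of long cycles at level
    \<open>b\<close> equals \<open>\<epsilon> / 2\<close>. The left end \<open>-1\<close> serves
    because periods are nonnegative.\<close>
  define b where "b = 2 * (exp 2 * real \<sigma>) / \<epsilon>"
  have b: "b > 0" "exp 2 * real \<sigma> / b = \<epsilon> / 2" using \<epsilon> assms by (simp_all add: b_def)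
  have "measure (scaled_period_law r \<sigma> n) {-1<..b} > 1 - \<epsilon>" for n
  proof -
    interpret real_distribution "scaled_period_law r \<sigma> n" by (rule rd)
    have "measure (scaled_period_law r \<sigma> n) {-1<..b} = cdf (scaled_period_law r \<sigma> n) b"
      using cdf_diff_eq[of "-1" b] b cdf_scaled_period_law_neg[OF r, of "-1" \<sigma> n] by simp
    also have "1 - \<epsilon> < \<dots>"
    proof (cases "n = 0")
      case True
      then show ?thesis using cdf_scaled_period_law_0[OF r assms(1), of b] b \<epsilon> by simp
    next
      case False
      then have n: "n > 0" by simp
      have "tail_prob r \<sigma> n (b * sqrt (real (n ^ \<sigma>)))
          \<le> moment \<sigma> (card (pwords n \<sigma>)) (n ^ \<sigma>) (b * sqrt (real (n ^ \<sigma>))) 1 0"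
        using b by (intro tail_prob_le assms n) simp
      also have "\<dots> \<le> \<epsilon> / 2"
        using moment_1_le[OF card_pwords_le assms(1) _ b(1), of n \<sigma>] n b(2) by simp
      finally show ?thesis unfolding cdf_scaled_period_law_tail[OF r n] using \<epsilon> by linarith
    qed
    finally show ?thesis .
  qed
  moreover have "-1 < b" using b by simp
  ultimately show "\<exists>a b. a < b \<and> (\<forall>n. 1 - \<epsilon> < measure (scaled_period_law r \<sigma> n) {a<..b})" by blast
qed

lemma cdf_scaled_period_law_convergent:
  assumes "0 < \<sigma>" "\<sigma> \<le> r" "x \<noteq> 0"
  shows "convergent (\<lambda>n. cdf (scaled_period_law r \<sigma> n) x)"
proof (cases "x < 0")
  case True
  then show ?thesis using assms by (simp add: cdf_scaled_period_law_neg convergent_const)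
next
  case False
  then have x: "x > 0" using assms by simp
  interpret scaling \<sigma> "\<lambda>n. card (pwords (Suc n) \<sigma>)" "\<lambda>n. Suc n ^ \<sigma>" "if even \<sigma> then 1 else 0"
    by (rule scaling_pwords[OF assms(1)])
  have "cdf (scaled_period_law r \<sigma> (Suc n)) x = (\<Sum>k. (-1) ^ k *
      (moment \<sigma> (card (pwords (Suc n) \<sigma>)) (Suc n ^ \<sigma>) (x * sqrt (real (Suc n ^ \<sigma>))) k 0 / fact k))" for n
  proof -
    have "(\<lambda>k. (-1) ^ k *
        (moment \<sigma> (card (pwords (Suc n) \<sigma>)) (Suc n ^ \<sigma>) (x * sqrt (real (Suc n ^ \<sigma>))) k 0 / fact k))
      sums (1 - tail_prob r \<sigma> (Suc n) (x * sqrt (real (Suc n ^ \<sigma>))))"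
      using x assms by (intro tail_prob_sums) auto
    then show ?thesis using assms cdf_scaled_period_law_tail[of r "Suc n" \<sigma> x] by (simp add: sums_iff)
  qed
  then have "convergent (\<lambda>n. cdf (scaled_period_law r \<sigma> (Suc n)) x)"
    using alternating_moments_convergent[OF x] by simp
  then show ?thesis unfolding convergent_def using filterlim_sequentially_Suc by blast
qed

text \<open>The condition on \<open>x\<close> makes the mean at most \<open>1\<close>, so the second
  moment, being at most its square, is at most the mean, and \<open>tail_prob_ge\<close> keeps half
  of the mean. The witness \<open>L / 8\<close> loses a factor \<open>2\<close> there, another in
  \<open>moment_1_ge\<close>, and another in replacing the limit \<open>L\<close> of the survival
  probabilities by \<open>L / 2\<close>.\<close>

lemma tail_prob_lower_bound:
  assumes "0 < \<sigma>" "\<sigma> \<le> r" "x > 0" "exp 2 * real \<sigma> \<le> x"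
  shows "\<exists>\<delta>>0. \<forall>\<^sub>F n in sequentially. \<delta> \<le> tail_prob r \<sigma> (Suc n) (x * sqrt (real (Suc n ^ \<sigma>)))"
proof -
  let ?a = "\<lambda>n. card (pwords (Suc n) \<sigma>)" and ?N = "\<lambda>n. Suc n ^ \<sigma>"
  interpret scaling \<sigma> ?a ?N "if even \<sigma> then 1 else 0"
    by (rule scaling_pwords[OF assms(1)])
  define M where "M n = nat \<lfloor>x * c n\<rfloor> + 1" for n
  have M: "(\<lambda>n. real (M n) / c n) \<longlonglongrightarrow> x"
    unfolding M_def using assms by (intro floor_scaled_tendsto) simp
  have "(\<lambda>n. 2 * (real (M n) / c n)) \<longlonglongrightarrow> 2 * x" by (intro tendsto_intros M)
  then have M2: "(\<lambda>n. real (2 * M n) / c n) \<longlonglongrightarrow> 2 * x" by simp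
  obtain L where L: "L > 0" "(\<lambda>n. survival \<sigma> (?a n) (?N n) (2 * M n)) \<longlonglongrightarrow> L"
    using survival_tendsto[OF M2] exp_gt_zero by blast
  have "(\<lambda>n. real (2 * M n) / c n * (1 / c n)) \<longlonglongrightarrow> 2 * x * 0"
    by (intro tendsto_intros M2 inv_c)
  then have "\<forall>\<^sub>F n in sequentially. real (2 * M n) / c n * (1 / c n) < 1"
    by (rule order_tendstoD) simp
  then have N: "\<forall>\<^sub>F n in sequentially. 2 * M n \<le> ?N n"
  proof eventually_elim
    case (elim n)
    have "real (2 * M n) / real (?N n) < 1"
      using elim unfolding times_divide_times_eq c_sq by simp
    then have "real (2 * M n) < real (?N n)" using N_pos[of n] by (simp only: divide_less_eq_1 of_nat_0_less_iff) auto
    then show ?case by (simp only: of_nat_less_iff less_imp_le)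
  qed
  have "\<forall>\<^sub>F n in sequentially. L / 2 < survival \<sigma> (?a n) (?N n) (2 * M n)"
    using L by (intro order_tendstoD) auto
  with N have "\<forall>\<^sub>F n in sequentially. L / 8 \<le> tail_prob r \<sigma> (Suc n) (x * c n)"
  proof eventually_elim
    case (elim n)
    let ?m = "\<lambda>k. moment \<sigma> (?a n) (?N n) (x * c n) k 0"
    have "survival \<sigma> (?a n) (?N n) (2 * M n) / 2 \<le> ?m 1"
      by (rule moment_1_ge[OF \<sigma> assms(3) a_le M_def elim(1) c_pos])
    then have lo: "L / 4 \<le> ?m 1" using elim by simp
    have "?m 1 \<le> exp 2 * real \<sigma> / x" by (rule moment_1_le[OF a_le \<sigma> N_pos assms(3)])
    also have "\<dots> \<le> 1" using assms by simp
    finally have "?m 1 * ?m 1 \<le> 1 * ?m 1" by (intro mult_right_mono moment_nonneg)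
    moreover have "?m 2 \<le> survival \<sigma> (?a n) (?N n) 0 * ?m 1 ^ 2" by (rule moment_le[OF a_le])
    ultimately have "?m 2 \<le> ?m 1" by (simp add: survival_def power2_eq_square)
    moreover have "?m 1 - ?m 2 / 2 \<le> tail_prob r \<sigma> (Suc n) (x * c n)"
      using assms by (intro tail_prob_ge) auto
    ultimately show ?case using lo by linarith
  qed
  with L(1) show ?thesis by (intro exI[of _ "L / 8"]) simp
qed

theorem theorem1:
  fixes r \<sigma> :: nat
  assumes "r \<ge> 2" and "\<sigma> \<ge> 1" and "\<sigma> \<le> r"
  shows "\<exists>M. real_distribution M \<and>
           weak_conv_m (\<lambda>n. scaled_period_law r \<sigma> n) M \<and>
           (\<forall>c. measure M {c} \<noteq> 1)"
proof -
  have \<sigma>: "\<sigma> > 0" and r: "r > 0" using assms by auto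
  obtain M where M: "real_distribution M" and wc: "weak_conv_m (scaled_period_law r \<sigma>) M"
    using tight_cdf_convergent_imp_weak_conv[OF tight_scaled_period_law[OF \<sigma> assms(3)]
        cdf_scaled_period_law_convergent[OF \<sigma> assms(3)]] by blast
  interpret real_distribution M by (rule M)
  have "measure M {c} \<noteq> 1" for c
  proof
    assume c: "measure M {c} = 1"
    \<comment> \<open>A level beyond the supposed atom \<open>c\<close> and high enough for
      \<open>tail_prob_lower_bound\<close>.\<close>
    define x where "x = max \<bar>c\<bar> (exp 2 * real \<sigma>) + 1"
    have x: "x > 0" "exp 2 * real \<sigma> \<le> x" "c < x" by (auto simp: x_def)
    \<comment> \<open>The atom takes all the mass, so \<open>x\<close> is a continuity point and the
      distribution functions converge there.\<close>
    have "measure M {c} + measure M {x} = measure M ({c} \<union> {x})"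
      using x(3) by (intro finite_measure_Union[symmetric]) auto
    also have "\<dots> \<le> 1" by (rule prob_le_1)
    finally have "measure M {x} = 0" using c measure_nonneg[of M "{x}"] by linarith
    then have "isCont (cdf M) x" by (simp add: isCont_cdf)
    then have "(\<lambda>n. cdf (scaled_period_law r \<sigma> n) x) \<longlonglongrightarrow> cdf M x"
      using wc by (simp add: weak_conv_m_def weak_conv_def)
    then have lim: "(\<lambda>n. cdf (scaled_period_law r \<sigma> (Suc n)) x) \<longlonglongrightarrow> cdf M x"
      by (rule LIMSEQ_Suc)
    have "measure M {c} \<le> cdf M x" unfolding cdf_def using x(3) by (intro finite_measure_mono) auto
    then have "1 \<le> cdf M x" using c by simp
    obtain \<delta> where \<delta>: "\<delta> > 0"
      "\<forall>\<^sub>F n in sequentially. \<delta> \<le> tail_prob r \<sigma> (Suc n) (x * sqrt (real (Suc n ^ \<sigma>)))"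
      using tail_prob_lower_bound[OF \<sigma> assms(3) x(1,2)] by blast
    from \<delta>(2) have "\<forall>\<^sub>F n in sequentially. cdf (scaled_period_law r \<sigma> (Suc n)) x \<le> 1 - \<delta>"
      by eventually_elim (use cdf_scaled_period_law_tail[OF r] in simp)
    then have "cdf M x \<le> 1 - \<delta>" by (rule tendsto_upperbound[OF lim _ sequentially_bot])
    then show False using \<open>1 \<le> cdf M x\<close> \<delta>(1) by simp
  qed
  with M wc show ?thesis by blast
qed

end
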